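(* If there is a polynomial-time $c$-approximation algorithm for the classical problem $R||C_{\max}$, then there is a polynomial-time $(c+1)$-approximation algorithm for $R|\mathcal{U}^\Gamma|C_{\max}$.
   Context: $R||C_{\max}$: given a set $J$ of jobs, a set $M$ of machines and processing times $p_{ij}\ge 0$ of job $j$ on machine $i$, find a schedule $\sigma:J\to M$ minimizing $\max_{i\in M}\sum_{j\in\sigma_i}p_{ij}$, where $\sigma_i=\sigma^{-1}(i)$. $R|\mathcal{U}^\Gamma|C_{\max}$ (robust scheduling on unrelated machines): the input is $J$, $M$, a positive integer $\Gamma$, nominal processing times $\overline p_{ij}\in\mathbb{Q}_{\ge 0}$ and deviations $\hat p_{ij}\in\mathbb{Q}_{\ge0}$ for $i\in M$, $j\in J$. For a schedule $\sigma:J\to M$ and machine $i$, let $\overline p(\sigma_i)=\sum_{j\in\sigma_i}\overline p_{ij}$, let $\Gamma(\sigma_i)$ be a set of $\Gamma$ jobs of $\sigma_i$ with largest $\hat p_{ij}$ values (ties broken arbitrarily; $\Gamma(\sigma_i)=\sigma_i$ if $|\sigma_i|<\Gamma$), and $\hat p_\Gamma(\sigma_i)=\sum_{j\in\Gamma(\sigma_i)}\hat p_{ij}$. The objective is to minimize $C_\Gamma(\sigma)=\max_{i\in M}\big(\overline p(\sigma_i)+\hat p_\Gamma(\sigma_i)\big)$, which equals $\max_{\xi\in\{0,1\}^{J},\|\xi\|_1\le\Gamma}\max_{i\in M}\sum_{j\in\sigma_i}(\overline p_{ij}+\xi_j\hat p_{ij})$. A $\rho$-approximation algorithm always outputs a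 schedule of objective value at most $\rho$ times the optimum. *)

theory Defs
  imports
    Complex_Main
    "HOL-Library.FuncSet"
    "HOL-Library.Log_Nat"
    "HOL-Computational_Algebra.Polynomial"
begin

section \<open>Machine model\<close>

text \<open>
  Algorithms are programs of a WHILE-style language over binary trees (cf. N. D. Jones,
  Computability and Complexity, 1997) whose leaves are natural numbers. Arithmetic is charged in
  terms of the bit lengths of its operands (logarithmic cost). Values are immutable and may be
  shared, so copying a value in \<open>Fork\<close> is a unit-cost pointer operation, and a run of cost \<open>t\<close>
  allocates at most \<open>t\<close> nodes and \<open>O(t)\<close> bits. Hence the model and multitape Turing machines
  simulate each other with polynomial overhead.
\<close>

datatype data = Atom nat | Node data data

text \<open>\<open>floorlog 2 n\<close> is the number of binary digits of \<open>n\<close> (and \<open>0\<close> for \<open>n = 0\<close>).\<close>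

primrec data_size :: "data \<Rightarrow> nat" where
  "data_size (Atom n) = 1 + floorlog 2 n"
| "data_size (Node a b) = 1 + data_size a + data_size b"

text \<open>Operations applied to arguments of the wrong shape yield \<open>Atom 0\<close>.\<close>

fun left :: "data \<Rightarrow> data" where
  "left (Node a b) = a"
| "left (Atom n) = Atom 0"

fun right :: "data \<Rightarrow> data" where
  "right (Node a b) = b"
| "right (Atom n) = Atom 0"

datatype arith = Add | Sub | Mul | Div

text \<open>Natural-number arithmetic: \<open>Sub\<close> is truncated at \<open>0\<close>, and division by \<open>0\<close> gives \<open>0\<close>.\<close>

primrec arith_fun :: "arith \<Rightarrow> nat \<Rightarrow> nat \<Rightarrow> nat" where
  "arith_fun Add a b = a + b"
| "arith_fun Sub a b = a - b"
| "arith_fun Mul a b = a * b"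
| "arith_fun Div a b = a div b"

fun arith_val :: "arith \<Rightarrow> data \<Rightarrow> data" where
  "arith_val f (Node (Atom a) (Atom b)) = Atom (arith_fun f a b)"
| "arith_val f _ = Atom 0"

text \<open>The schoolbook bound for multiplication and division, charged for all four operations.\<close>

fun arith_cost :: "data \<Rightarrow> nat" where
  "arith_cost (Node (Atom a) (Atom b)) = data_size (Atom a) * data_size (Atom b)"
| "arith_cost _ = 1"

text \<open>
  A program maps a value to a value: \<open>Fork p q\<close> runs \<open>p\<close> and \<open>q\<close> on the same input and pairs the
  results, and \<open>Cond\<close> and \<open>While\<close> test whether the result of their first argument differs from
  \<open>Atom 0\<close>.
\<close>

datatype prog =
    Skip
  | Lit nat
  | Fst
  | Snd
  | Arith arith
  | Fork prog prog
  | Seq prog prog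
  | Cond prog prog prog
  | While prog prog

text \<open>\<open>runs p x y t\<close>: on input \<open>x\<close>, program \<open>p\<close> halts with output \<open>y\<close> at cost \<open>t\<close>.\<close>

inductive runs :: "prog \<Rightarrow> data \<Rightarrow> data \<Rightarrow> nat \<Rightarrow> bool" where
  Skip: "runs Skip x x 1"
| Lit: "runs (Lit n) x (Atom n) 1"
| Fst: "runs Fst x (left x) 1"
| Snd: "runs Snd x (right x) 1"
| Arith: "runs (Arith f) x (arith_val f x) (arith_cost x)"
| Fork: "runs p x y s \<Longrightarrow> runs q x z t \<Longrightarrow> runs (Fork p q) x (Node y z) (s + t + 1)"
| Seq: "runs p x y s \<Longrightarrow> runs q y z t \<Longrightarrow> runs (Seq p q) x z (s + t + 1)"
| Cond_true: "runs b x v s \<Longrightarrow> v \<noteq> Atom 0 \<Longrightarrow> runs p x y t \<Longrightarrow> runs (Cond b p q) x y (s + t + 1)"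
| Cond_false: "runs b x (Atom 0) s \<Longrightarrow> runs q x y t \<Longrightarrow> runs (Cond b p q) x y (s + t + 1)"
| While_true: "runs b x v s \<Longrightarrow> v \<noteq> Atom 0 \<Longrightarrow> runs p x y t \<Longrightarrow> runs (While b p) y z u
    \<Longrightarrow> runs (While b p) x z (s + t + u + 1)"
| While_false: "runs b x (Atom 0) s \<Longrightarrow> runs (While b p) x x (s + 1)"

inductive_cases runs_SkipE: "runs Skip x y t"
inductive_cases runs_LitE: "runs (Lit n) x y t"
inductive_cases runs_FstE: "runs Fst x y t"
inductive_cases runs_SndE: "runs Snd x y t"
inductive_cases runs_ArithE: "runs (Arith f) x y t"
inductive_cases runs_ForkE: "runs (Fork p q) x y t"
inductive_cases runs_SeqE: "runs (Seq p q) x y t"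
inductive_cases runs_CondE: "runs (Cond b p q) x y t"
inductive_cases runs_WhileE: "runs (While b p) x y t"

lemma runs_deterministic:
  "runs p x y t \<Longrightarrow> runs p x y' t' \<Longrightarrow> y' = y \<and> t' = t"
proof (induction arbitrary: y' t' rule: runs.induct)
  case Skip then show ?case by (auto elim: runs_SkipE)
next
  case Lit then show ?case by (auto elim: runs_LitE)
next
  case Fst then show ?case by (auto elim: runs_FstE)
next
  case Snd then show ?case by (auto elim: runs_SndE)
next
  case Arith then show ?case by (auto elim: runs_ArithE)
next
  case Fork show ?case using Fork.prems by (rule runs_ForkE) (metis Fork.IH Suc_eq_plus1)
next
  case Seq show ?case using Seq.prems by (rule runs_SeqE) (metis Seq.IH Suc_eq_plus1)
next
  case Cond_true
  show ?case using Cond_true.prems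
    by (rule runs_CondE) (metis Cond_true.IH Cond_true.hyps Suc_eq_plus1)+
next
  case Cond_false
  show ?case using Cond_false.prems by (rule runs_CondE) (metis Cond_false.IH Suc_eq_plus1)+
next
  case While_true
  show ?case using While_true.prems
    by (rule runs_WhileE) (metis While_true.IH While_true.hyps Suc_eq_plus1)+
next
  case While_false
  show ?case using While_false.prems by (rule runs_WhileE) (metis While_false.IH Suc_eq_plus1)+
qed


section \<open>Scheduling on unrelated machines\<close>

text \<open>
  The job set is \<open>{..<njobs I}\<close> and the machine set is \<open>{..<nmachs I}\<close>. Processing times take the
  machine as first and the job as second argument; values outside these ranges are irrelevant.
\<close>

record sched_instance =
  njobs :: nat
  nmachs :: nat

record rcmax_instance = sched_instance +
  ptime :: "nat \<Rightarrow> nat \<Rightarrow> rat"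

record robust_instance = sched_instance +
  budget :: nat
  nominal :: "nat \<Rightarrow> nat \<Rightarrow> rat"
  deviation :: "nat \<Rightarrow> nat \<Rightarrow> rat"

definition schedules :: "'a sched_instance_scheme \<Rightarrow> (nat \<Rightarrow> nat) set" where
  "schedules I = {..<njobs I} \<rightarrow>\<^sub>E {..<nmachs I}"

definition assigned :: "'a sched_instance_scheme \<Rightarrow> (nat \<Rightarrow> nat) \<Rightarrow> nat \<Rightarrow> nat set" where
  "assigned I \<sigma> i = {j. j < njobs I \<and> \<sigma> j = i}"

text \<open>At least one machine is required, so that schedules exist and maxima over machines are proper.\<close>

definition valid_rcmax :: "rcmax_instance \<Rightarrow> bool" where
  "valid_rcmax I \<longleftrightarrow> nmachs I > 0 \<and> (\<forall>i<nmachs I. \<forall>j<njobs I. ptime I i j \<ge> 0)"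

definition makespan :: "rcmax_instance \<Rightarrow> (nat \<Rightarrow> nat) \<Rightarrow> rat" where
  "makespan I \<sigma> = Max ((\<lambda>i. \<Sum>j\<in>assigned I \<sigma> i. ptime I i j) ` {..<nmachs I})"

definition valid_robust :: "robust_instance \<Rightarrow> bool" where
  "valid_robust I \<longleftrightarrow> nmachs I > 0 \<and> budget I > 0 \<and>
    (\<forall>i<nmachs I. \<forall>j<njobs I. nominal I i j \<ge> 0 \<and> deviation I i j \<ge> 0)"

text \<open>
  \<open>top_jobs k d S\<close> is some choice of \<open>k\<close> elements of \<open>S\<close> with largest \<open>d\<close>-values, and \<open>S\<close> itself if
  \<open>card S < k\<close>.
\<close>

definition is_top_jobs :: "nat \<Rightarrow> (nat \<Rightarrow> rat) \<Rightarrow> nat set \<Rightarrow> nat set \<Rightarrow> bool" where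
  "is_top_jobs k d S T \<longleftrightarrow>
    T \<subseteq> S \<and> card T = min k (card S) \<and> (\<forall>j\<in>T. \<forall>l\<in>S - T. d l \<le> d j)"

definition top_jobs :: "nat \<Rightarrow> (nat \<Rightarrow> rat) \<Rightarrow> nat set \<Rightarrow> nat set" where
  "top_jobs k d S = (SOME T. is_top_jobs k d S T)"

definition robust_makespan :: "robust_instance \<Rightarrow> (nat \<Rightarrow> nat) \<Rightarrow> rat" where
  "robust_makespan I \<sigma> = Max ((\<lambda>i.
      (\<Sum>j\<in>assigned I \<sigma> i. nominal I i j) +
      (\<Sum>j\<in>top_jobs (budget I) (deviation I i) (assigned I \<sigma> i). deviation I i j))
    ` {..<nmachs I})"


section \<open>Encodings\<close>

primrec enc_list :: "('a \<Rightarrow> data) \<Rightarrow> 'a list \<Rightarrow> data" where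
  "enc_list f [] = Atom 0"
| "enc_list f (x # xs) = Node (f x) (enc_list f xs)"

text \<open>A nonnegative rational is encoded as its reduced numerator and (positive) denominator.\<close>

definition enc_rat :: "rat \<Rightarrow> data" where
  "enc_rat r = Node (Atom (nat (fst (quotient_of r)))) (Atom (nat (snd (quotient_of r))))"

definition enc_matrix :: "nat \<Rightarrow> nat \<Rightarrow> (nat \<Rightarrow> nat \<Rightarrow> rat) \<Rightarrow> data" where
  "enc_matrix m n p = enc_list (\<lambda>i. enc_list (\<lambda>j. enc_rat (p i j)) [0..<n]) [0..<m]"

definition enc_rcmax :: "rcmax_instance \<Rightarrow> data" where
  "enc_rcmax I =
    Node (Atom (njobs I)) (Node (Atom (nmachs I)) (enc_matrix (nmachs I) (njobs I) (ptime I)))"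

definition enc_robust :: "robust_instance \<Rightarrow> data" where
  "enc_robust I =
    Node (Atom (njobs I)) (Node (Atom (nmachs I)) (Node (Atom (budget I))
      (Node (enc_matrix (nmachs I) (njobs I) (nominal I))
            (enc_matrix (nmachs I) (njobs I) (deviation I)))))"

definition enc_schedule :: "'a sched_instance_scheme \<Rightarrow> (nat \<Rightarrow> nat) \<Rightarrow> data" where
  "enc_schedule I \<sigma> = enc_list (\<lambda>j. Atom (\<sigma> j)) [0..<njobs I]"


section \<open>Polynomial-time approximation algorithms\<close>

definition opt_value ::
  "('a sched_instance_scheme \<Rightarrow> (nat \<Rightarrow> nat) \<Rightarrow> rat) \<Rightarrow> 'a sched_instance_scheme \<Rightarrow> rat" where
  "opt_value obj I = Min (obj I ` schedules I)"

definition poly_time_approx ::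
  "('a sched_instance_scheme \<Rightarrow> bool) \<Rightarrow> ('a sched_instance_scheme \<Rightarrow> data) \<Rightarrow>
   ('a sched_instance_scheme \<Rightarrow> (nat \<Rightarrow> nat) \<Rightarrow> rat) \<Rightarrow> real \<Rightarrow> prog \<Rightarrow> bool" where
  "poly_time_approx valid enc obj \<rho> P \<longleftrightarrow>
    (\<exists>q :: nat poly. \<forall>I. valid I \<longrightarrow>
      (\<exists>\<sigma> t. \<sigma> \<in> schedules I \<and> runs P (enc I) (enc_schedule I \<sigma>) t \<and>
        t \<le> poly q (data_size (enc I)) \<and>
        real_of_rat (obj I \<sigma>) \<le> \<rho> * real_of_rat (opt_value obj I)))"

definition rcmax_approx :: "real \<Rightarrow> prog \<Rightarrow> bool" where
  "rcmax_approx = poly_time_approx valid_rcmax enc_rcmax makespan"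

definition robust_approx :: "real \<Rightarrow> prog \<Rightarrow> bool" where
  "robust_approx = poly_time_approx valid_robust enc_robust robust_makespan"

end

theory Submission
  imports Defs
begin

text \<open>
  Guess a threshold \<open>\<theta>\<close> and solve the classical instance in which a job pays, besides its nominal
  time, its full deviation if that exceeds \<open>\<theta>\<close> and nothing otherwise. The cheap jobs then add at
  most \<open>\<Gamma>\<theta>\<close> to the worst case of a machine. If \<open>\<theta>\<close> is the largest element of \<open>{0}\<close> and the set of
  deviations with \<open>\<Gamma>\<theta> \<le> OPT\<close>, then each expensive job deviates by more than \<open>OPT/\<Gamma>\<close>, so in an
  optimal schedule the expensive jobs of a machine are all among its \<open>\<Gamma>\<close> worst jobs. Hence the
  classical optimum is at most \<open>OPT\<close>, and the solution found has robust value at most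
  \<open>c OPT + \<Gamma>\<theta> \<le> (c + 1) OPT\<close>. As \<open>OPT\<close> is unknown, all thresholds are tried and the solution with
  the least upper bound (classical makespan plus \<open>\<Gamma>\<theta>\<close>) is returned. Multiplying all times by the
  product of the denominators first makes all numbers natural, so that the classical instances
  can be written down in reduced form without computing greatest common divisors.
\<close>

section \<open>Scaling and truncation\<close>

definition rnum :: "rat \<Rightarrow> nat" where "rnum r = nat (fst (quotient_of r))"
definition rden :: "rat \<Rightarrow> nat" where "rden r = nat (snd (quotient_of r))"

text \<open>Multiplication comes before division, so the quotient is exact as soon as
  \<open>rden r\<close> divides \<open>K\<close>. The formula uses only the two numbers stored in
  the encoding of \<open>r\<close>.\<close>

definition scale :: "nat \<Rightarrow> rat \<Rightarrow> nat" where
  "scale K r = rnum r * K div rden r"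

lemma rden_pos: "rden r > 0"
  using quotient_of_denom_pos'[of r] by (simp add: rden_def)

lemma enc_rat_eq: "enc_rat r = Node (Atom (rnum r)) (Atom (rden r))"
  by (simp add: enc_rat_def rnum_def rden_def)

lemma of_nat_scale:
  assumes "r \<ge> 0" "rden r dvd K"
  shows "rat_of_nat (scale K r) = of_nat K * r"
proof -
  obtain a b where q: "quotient_of r = (a, b)" by force
  then have b: "b > 0" by (rule quotient_of_denom_pos)
  have r: "r = of_int a / of_int b" using q by (rule quotient_of_div)
  with assms(1) b have "a \<ge> 0" by (simp add: zero_le_divide_iff)
  with r b q have "r = of_nat (rnum r) / of_nat (rden r)"
    by (simp add: rnum_def rden_def)
  moreover obtain m where K: "K = rden r * m" using assms(2) by blast
  ultimately show ?thesis
    using rden_pos[of r] by (simp add: scale_def K field_simps)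
qed

text \<open>The value may be exponential in the input size, but its bit length is controlled by the
  sum of the bit lengths of the factors. This is all that logarithmic-cost arithmetic
  requires.\<close>

definition common_den :: "robust_instance \<Rightarrow> nat" where
  "common_den I = (\<Prod>i<nmachs I. \<Prod>j<njobs I. rden (nominal I i j) * rden (deviation I i j))"

definition nom :: "robust_instance \<Rightarrow> nat \<Rightarrow> nat \<Rightarrow> nat" where
  "nom I i j = scale (common_den I) (nominal I i j)"

definition dev :: "robust_instance \<Rightarrow> nat \<Rightarrow> nat \<Rightarrow> nat" where
  "dev I i j = scale (common_den I) (deviation I i j)"

definition trunc_time :: "robust_instance \<Rightarrow> nat \<Rightarrow> nat \<Rightarrow> nat \<Rightarrow> nat" where
  "trunc_time I \<theta> i j = nom I i j + (if \<theta> < dev I i j then dev I i j else 0)"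

definition reduced :: "robust_instance \<Rightarrow> nat \<Rightarrow> rcmax_instance" where
  "reduced I \<theta> = \<lparr>njobs = njobs I, nmachs = nmachs I, ptime = (\<lambda>i j. of_nat (trunc_time I \<theta> i j))\<rparr>"

text \<open>
  Upper bound on the scaled robust makespan: the jobs with deviation at most \<open>\<theta>\<close> contribute at
  most \<open>budget I * \<theta>\<close> to the worst case of a machine.
\<close>

definition ubound :: "robust_instance \<Rightarrow> nat \<Rightarrow> (nat \<Rightarrow> nat) \<Rightarrow> nat" where
  "ubound I \<theta> \<sigma> = Max (insert 0 ((\<lambda>i. \<Sum>j<njobs I. if \<sigma> j = i then trunc_time I \<theta> i j else 0) ` {..<nmachs I}))
    + budget I * \<theta>"

text \<open>The candidates are put on one index \<open>0, ..., nmachs I * njobs I\<close>, so that a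
  single loop can try them: first 0, then the matrix of scaled deviations row by row.\<close>

fun threshold :: "robust_instance \<Rightarrow> nat \<Rightarrow> nat" where
  "threshold I 0 = 0"
| "threshold I (Suc k) = dev I (k div njobs I) (k mod njobs I)"

lemma reduced_simps [simp]:
  "njobs (reduced I \<theta>) = njobs I" "nmachs (reduced I \<theta>) = nmachs I"
  "ptime (reduced I \<theta>) i j = of_nat (trunc_time I \<theta> i j)"
  "schedules (reduced I \<theta>) = schedules I"
  "assigned (reduced I \<theta>) \<sigma> = assigned I \<sigma>"
  "enc_schedule (reduced I \<theta>) = enc_schedule I"
  by (auto simp: reduced_def schedules_def assigned_def enc_schedule_def fun_eq_iff)

lemma valid_reduced: "valid_robust I \<Longrightarrow> valid_rcmax (reduced I \<theta>)"
  by (simp add: valid_robust_def valid_rcmax_def)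

lemma common_den_pos: "common_den I > 0"
  by (simp add: common_den_def rden_pos prod_pos)

lemma rden_dvd_common_den:
  assumes "i < nmachs I" "j < njobs I"
  shows "rden (nominal I i j) dvd common_den I" "rden (deviation I i j) dvd common_den I"
proof -
  have "rden (nominal I i j) * rden (deviation I i j) dvd
      (\<Prod>j<njobs I. rden (nominal I i j) * rden (deviation I i j))"
    using assms by (intro dvd_prodI) auto
  also have "\<dots> dvd common_den I"
    unfolding common_den_def using assms by (intro dvd_prodI) auto
  finally show "rden (nominal I i j) dvd common_den I" "rden (deviation I i j) dvd common_den I"
    by (blast intro: dvd_mult_left dvd_mult_right)+
qed

lemma of_nat_nom_dev:
  assumes "valid_robust I" "i < nmachs I" "j < njobs I"
  shows "rat_of_nat (nom I i j) = of_nat (common_den I) * nominal I i j"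
    and "rat_of_nat (dev I i j) = of_nat (common_den I) * deviation I i j"
  using assms rden_dvd_common_den[OF assms(2,3)]
  by (simp_all add: nom_def dev_def of_nat_scale valid_robust_def)

section \<open>Worst jobs of a machine, robust loads and truncated loads\<close>

text \<open>Greedy choice: as long as jobs are left, one with the largest remaining value joins the
  set. Existence is what gives the \<open>SOME\<close> in \<open>top_jobs\<close> its
  meaning.\<close>

lemma ex_is_top_jobs:
  assumes "finite S"
  shows "\<exists>T. is_top_jobs k d S T"
proof (induction k)
  case 0
  show ?case by (rule exI[of _ "{}"]) (simp add: is_top_jobs_def)
next
  case (Suc k)
  then obtain T where T: "T \<subseteq> S" "card T = min k (card S)" "\<forall>j\<in>T. \<forall>l\<in>S - T. d l \<le> d j"
    unfolding is_top_jobs_def by blast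
  show ?case
  proof (cases "T = S")
    case True
    with T show ?thesis by (intro exI[of _ S]) (auto simp: is_top_jobs_def)
  next
    case False
    with T assms have "Max (d ` (S - T)) \<in> d ` (S - T)" by (intro Max_in) auto
    then obtain m where m: "m \<in> S - T" "d m = Max (d ` (S - T))" by force
    then have max: "d l \<le> d m" if "l \<in> S - T" for l using that assms by simp
    have "card T < card S" using T(1) False assms by (intro psubset_card_mono) auto
    moreover have "finite T" using T(1) assms finite_subset by blast
    ultimately have "card (insert m T) = min (Suc k) (card S)" using m T(2) by simp
    with T m max show ?thesis
      by (intro exI[of _ "insert m T"]) (auto simp: is_top_jobs_def)
  qed
qed

lemma is_top_jobs_top_jobs: "finite S \<Longrightarrow> is_top_jobs k d S (top_jobs k d S)"
  unfolding top_jobs_def by (rule someI_ex) (rule ex_is_top_jobs)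

lemma finite_assigned [simp]: "finite (assigned I \<sigma> i)"
  by (simp add: assigned_def)

lemma sum_assigned: "(\<Sum>j\<in>assigned I \<sigma> i. f j) = (\<Sum>j<njobs I. if \<sigma> j = i then f j else 0)"
proof -
  have "assigned I \<sigma> i = {j \<in> {..<njobs I}. \<sigma> j = i}" by (auto simp: assigned_def)
  then show ?thesis by (simp only: sum.inter_filter finite_lessThan)
qed

definition load :: "robust_instance \<Rightarrow> (nat \<Rightarrow> nat) \<Rightarrow> nat \<Rightarrow> rat" where
  "load I \<sigma> i = (\<Sum>j\<in>assigned I \<sigma> i. nominal I i j) +
    (\<Sum>j\<in>top_jobs (budget I) (deviation I i) (assigned I \<sigma> i). deviation I i j)"

lemma top_jobs_subset: "top_jobs k d (assigned I \<sigma> i) \<subseteq> assigned I \<sigma> i"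
  using is_top_jobs_top_jobs[OF finite_assigned] unfolding is_top_jobs_def by blast

text \<open>Only the summands are scaled. The worst jobs are still selected by the original
  deviations, so no two selections have to be compared.\<close>

lemma scaled_load:
  assumes "valid_robust I" "i < nmachs I"
  shows "of_nat (common_den I) * load I \<sigma> i = rat_of_nat ((\<Sum>j\<in>assigned I \<sigma> i. nom I i j) +
    (\<Sum>j\<in>top_jobs (budget I) (deviation I i) (assigned I \<sigma> i). dev I i j))"
proof -
  have "j < njobs I" if "j \<in> assigned I \<sigma> i" for j using that by (simp add: assigned_def)
  with top_jobs_subset[of "budget I" "deviation I i" I \<sigma> i] show ?thesis
    unfolding load_def of_nat_add of_nat_sum distrib_left sum_distrib_left
    by (intro arg_cong2[where f = "(+)"] sum.cong refl of_nat_nom_dev[OF assms, symmetric]) auto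
qed

text \<open>Truncation lowers the time of a job by at most \<theta>, and only the at most
  \<open>budget I\<close> worst jobs of the machine pay their deviation.\<close>

lemma load_le_trunc:
  assumes "valid_robust I" "i < nmachs I"
  shows "of_nat (common_den I) * load I \<sigma> i
    \<le> rat_of_nat ((\<Sum>j\<in>assigned I \<sigma> i. trunc_time I \<theta> i j) + budget I * \<theta>)"
proof -
  let ?S = "assigned I \<sigma> i"
  let ?T = "top_jobs (budget I) (deviation I i) ?S"
  let ?d = "\<lambda>j. if \<theta> < dev I i j then dev I i j else 0"
  have T: "?T \<subseteq> ?S" "card ?T \<le> budget I"
    using is_top_jobs_top_jobs[of ?S] unfolding is_top_jobs_def by auto
  have "(\<Sum>j\<in>?T. dev I i j) \<le> (\<Sum>j\<in>?T. ?d j + \<theta>)"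
    by (rule sum_mono) auto
  also have "\<dots> = (\<Sum>j\<in>?T. ?d j) + card ?T * \<theta>" by (simp add: sum.distrib)
  also have "\<dots> \<le> (\<Sum>j\<in>?S. ?d j) + budget I * \<theta>"
    using T by (intro add_mono sum_mono2 mult_right_mono) auto
  finally have "(\<Sum>j\<in>?S. nom I i j) + (\<Sum>j\<in>?T. dev I i j)
      \<le> (\<Sum>j\<in>?S. trunc_time I \<theta> i j) + budget I * \<theta>"
    by (simp add: trunc_time_def sum.distrib)
  then show ?thesis unfolding scaled_load[OF assms] of_nat_le_iff .
qed

text \<open>If an expensive job were missing from the worst jobs, there would be
  \<open>budget I\<close> of them, each deviating at least as much, and together they would exceed
  \<open>V\<close>. So all deviations kept by truncation are already paid in the robust load.
  \<open>V\<close> is not tied to the machine because one threshold, chosen relative to the optimum,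
  must serve all machines.\<close>

lemma trunc_le_load:
  assumes valid: "valid_robust I" and i: "i < nmachs I"
    and V: "of_nat (common_den I) * load I \<sigma> i \<le> V"
    and large: "\<And>j. j < njobs I \<Longrightarrow> \<theta> < dev I i j \<Longrightarrow> V < of_nat (budget I * dev I i j)"
  shows "rat_of_nat (\<Sum>j\<in>assigned I \<sigma> i. trunc_time I \<theta> i j) \<le> V"
proof -
  let ?S = "assigned I \<sigma> i"
  let ?T = "top_jobs (budget I) (deviation I i) ?S"
  let ?L = "{j \<in> ?S. \<theta> < dev I i j}"
  have T: "?T \<subseteq> ?S" "card ?T = min (budget I) (card ?S)"
      "\<forall>j\<in>?T. \<forall>l\<in>?S - ?T. deviation I i l \<le> deviation I i j"
    using is_top_jobs_top_jobs[of ?S] unfolding is_top_jobs_def by auto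
  have fin: "finite ?T" using T(1) finite_subset by fastforce
  have V': "rat_of_nat ((\<Sum>j\<in>?S. nom I i j) + (\<Sum>j\<in>?T. dev I i j)) \<le> V"
    using V unfolding scaled_load[OF valid i] .
  have "?L \<subseteq> ?T"
  proof
    fix l assume l: "l \<in> ?L"
    show "l \<in> ?T"
    proof (rule ccontr)
      \<comment> \<open>As some job of the machine is left out, the minimum in the cardinality of
        the worst jobs is \<open>budget I\<close>.\<close>
      assume notin: "l \<notin> ?T"
      with l T(1) have "?T \<subset> ?S" by auto
      then have "card ?T < card ?S" by (rule psubset_card_mono[rotated]) simp
      with T(2) have card: "card ?T = budget I" by simp
      have "dev I i l \<le> dev I i j" if "j \<in> ?T" for j
      proof -
        have "j < njobs I" "l < njobs I" using that l T(1) by (auto simp: assigned_def)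
        then have "rat_of_nat (dev I i l) \<le> of_nat (dev I i j)"
          using that T(3) l notin by (simp add: of_nat_nom_dev[OF valid i] mult_left_mono)
        then show ?thesis by simp
      qed
      from sum_bounded_below[of ?T, OF this] have "budget I * dev I i l \<le> (\<Sum>j\<in>?T. dev I i j)"
        by (simp add: card)
      then have "rat_of_nat (budget I * dev I i l) \<le> V"
        using V' by (intro order_trans[OF _ V']) (simp only: of_nat_le_iff trans_le_add2)
      moreover have "V < of_nat (budget I * dev I i l)"
        using l by (intro large) (auto simp: assigned_def)
      ultimately show False by simp
    qed
  qed
  then have "(\<Sum>j\<in>?L. dev I i j) \<le> (\<Sum>j\<in>?T. dev I i j)"
    using fin by (intro sum_mono2) auto
  then have "(\<Sum>j\<in>?S. trunc_time I \<theta> i j) \<le> (\<Sum>j\<in>?S. nom I i j) + (\<Sum>j\<in>?T. dev I i j)"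
    by (simp add: trunc_time_def sum.distrib sum.inter_filter)
  then show ?thesis using V' by (meson of_nat_le_iff order_trans)
qed

section \<open>Optimal values and the quality of the best threshold\<close>

lemma finite_schedules: "finite (schedules I)"
  by (simp add: schedules_def finite_PiE)

lemma schedules_nonempty: "nmachs I > 0 \<Longrightarrow> schedules I \<noteq> {}"
  by (auto simp: schedules_def PiE_eq_empty_iff)

lemma opt_value_le: "\<sigma> \<in> schedules I \<Longrightarrow> opt_value obj I \<le> obj I \<sigma>"
  unfolding opt_value_def by (intro Min_le) (auto simp: finite_schedules)

lemma opt_value_attained:
  assumes "nmachs I > 0"
  obtains \<sigma> where "\<sigma> \<in> schedules I" "opt_value obj I = obj I \<sigma>"
proof -
  have "Min (obj I ` schedules I) \<in> obj I ` schedules I"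
    by (intro Min_in) (auto simp: finite_schedules schedules_nonempty[OF assms])
  then show thesis using that unfolding opt_value_def by auto
qed

text \<open>The 0 inserted into the maximum changes nothing, since there is a machine and all sums
  are natural numbers.\<close>

lemma ubound_eq_makespan:
  assumes "nmachs I > 0"
  shows "rat_of_nat (ubound I \<theta> \<sigma>) = makespan (reduced I \<theta>) \<sigma> + of_nat (budget I * \<theta>)"
proof -
  let ?f = "\<lambda>i. \<Sum>j<njobs I. if \<sigma> j = i then trunc_time I \<theta> i j else 0"
  have ne: "?f ` {..<nmachs I} \<noteq> {}" using assms by auto
  have "Max (insert 0 (?f ` {..<nmachs I})) = Max (?f ` {..<nmachs I})"
    using ne by (subst Max_insert) auto
  moreover have "rat_of_nat (Max (?f ` {..<nmachs I})) = Max (rat_of_nat ` ?f ` {..<nmachs I})"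
    using ne by (intro mono_Max_commute) (auto simp: mono_def)
  ultimately show ?thesis
    unfolding ubound_def makespan_def reduced_simps of_nat_add
    by (simp add: sum_assigned image_image of_nat_sum if_distrib[of rat_of_nat] cong: if_cong)
qed

lemma robust_makespan_load: "robust_makespan I \<sigma> = Max (load I \<sigma> ` {..<nmachs I})"
  by (simp add: robust_makespan_def load_def)

lemma robust_le_ubound:
  assumes "valid_robust I"
  shows "of_nat (common_den I) * robust_makespan I \<sigma> \<le> rat_of_nat (ubound I \<theta> \<sigma>)"
proof -
  have m: "nmachs I > 0" using assms by (simp add: valid_robust_def)
  then have "robust_makespan I \<sigma> \<in> load I \<sigma> ` {..<nmachs I}"
    unfolding robust_makespan_load by (intro Max_in) auto
  then obtain i where i: "i < nmachs I" "robust_makespan I \<sigma> = load I \<sigma> i" by auto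
  have "(\<Sum>j\<in>assigned I \<sigma> i. trunc_time I \<theta> i j) + budget I * \<theta> \<le> ubound I \<theta> \<sigma>"
    unfolding ubound_def sum_assigned using i(1) by (intro add_mono Max_ge) auto
  with load_le_trunc[OF assms i(1), of \<sigma> \<theta>] show ?thesis
    unfolding i(2) by (meson of_nat_le_iff order_trans)
qed

lemma reduced_le_robust:
  assumes valid: "valid_robust I"
    and large: "\<And>i j. i < nmachs I \<Longrightarrow> j < njobs I \<Longrightarrow> \<theta> < dev I i j
      \<Longrightarrow> of_nat (common_den I) * robust_makespan I \<sigma> < of_nat (budget I * dev I i j)"
  shows "makespan (reduced I \<theta>) \<sigma> \<le> of_nat (common_den I) * robust_makespan I \<sigma>"
proof -
  have "of_nat (common_den I) * load I \<sigma> i \<le> of_nat (common_den I) * robust_makespan I \<sigma>"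
    if "i < nmachs I" for i
    unfolding robust_makespan_load using that by (intro mult_left_mono Max_ge) auto
  with trunc_le_load[OF valid _ this large] show ?thesis
    using valid unfolding makespan_def
    by (intro Max.boundedI) (auto simp: valid_robust_def)
qed

lemma robust_makespan_nonneg:
  assumes "valid_robust I"
  shows "robust_makespan I \<sigma> \<ge> 0"
proof -
  have "robust_makespan I \<sigma> \<ge> load I \<sigma> 0"
    unfolding robust_makespan_load using assms by (intro Max_ge) (auto simp: valid_robust_def)
  \<comment> \<open>By \<open>scaled_load\<close> this product is the image of a natural
    number.\<close>
  moreover have "of_nat (common_den I) * load I \<sigma> 0 \<ge> 0"
    using assms by (subst scaled_load) (simp_all add: valid_robust_def del: of_nat_add of_nat_sum)
  ultimately show ?thesis
    using common_den_pos[of I] by (simp add: zero_le_mult_iff)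
qed

text \<open>The largest candidate within the bound is taken. Every scaled deviation is itself a
  candidate, so one above the chosen threshold must violate the bound.\<close>

lemma ex_threshold:
  assumes "V \<ge> 0"
  obtains k where "k \<le> nmachs I * njobs I" "rat_of_nat (budget I * threshold I k) \<le> V"
    "\<And>i j. i < nmachs I \<Longrightarrow> j < njobs I \<Longrightarrow> threshold I k < dev I i j \<Longrightarrow> V < of_nat (budget I * dev I i j)"
proof -
  let ?A = "{k \<in> {..nmachs I * njobs I}. rat_of_nat (budget I * threshold I k) \<le> V}"
  \<comment> \<open>Index 0 stands for the threshold 0, which is always within the bound; hence the
    maximum exists even without jobs.\<close>
  have "0 \<in> ?A" using assms by simp
  then have "Max (threshold I ` ?A) \<in> threshold I ` ?A" by (intro Max_in) auto
  then obtain k where k: "k \<in> ?A" "Max (threshold I ` ?A) = threshold I k" by auto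
  have "V < of_nat (budget I * dev I i j)"
    if ij: "i < nmachs I" "j < njobs I" and less: "threshold I k < dev I i j" for i j
  proof (rule ccontr)
    assume not: "\<not> ?thesis"
    \<comment> \<open>Position of machine \<open>i\<close> and job \<open>j\<close> in the
      row-by-row enumeration; \<open>Suc\<close> skips the candidate 0.\<close>
    let ?l = "i * njobs I + j"
    have "?l < Suc i * njobs I" using ij(2) by simp
    also have "\<dots> \<le> nmachs I * njobs I" using ij(1) by (intro mult_right_mono) auto
    finally have l: "Suc ?l \<le> nmachs I * njobs I" by simp
    have eq: "threshold I (Suc ?l) = dev I i j" using ij(2) by simp
    have "threshold I (Suc ?l) \<le> Max (threshold I ` ?A)"
    proof (rule Max_ge)
      have "Suc ?l \<in> ?A" using l not eq by (simp only: mem_Collect_eq atMost_iff not_less)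
      then show "threshold I (Suc ?l) \<in> threshold I ` ?A" by (rule imageI)
    qed simp
    with k(2) eq less show False by simp
  qed
  with k(1) that[of k] show thesis by blast
qed

text \<open>Multiplying an estimate of the optimum by \<open>c\<close> needs its sign. One job of
  length 1 on one machine forces every schedule and the optimum to have value 1, whence
  \<open>1 \<le> c\<close>.\<close>

lemma approx_ratio_nonneg:
  assumes "rcmax_approx c P"
  shows "c \<ge> 0"
proof -
  define J :: rcmax_instance where "J = \<lparr>njobs = 1, nmachs = 1, ptime = (\<lambda>_ _. 1)\<rparr>"
  have one: "makespan J \<sigma> = 1" if "\<sigma> \<in> schedules J" for \<sigma>
  proof -
    have "assigned J \<sigma> 0 = {0}" using that by (auto simp: J_def schedules_def assigned_def PiE_def Pi_def)
    then show ?thesis by (simp add: makespan_def J_def lessThan_Suc)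
  qed
  have J: "valid_rcmax J" by (simp add: valid_rcmax_def J_def)
  obtain \<sigma> where "\<sigma> \<in> schedules J" "real_of_rat (makespan J \<sigma>) \<le> c * real_of_rat (opt_value makespan J)"
    using assms J unfolding rcmax_approx_def poly_time_approx_def by blast
  moreover have "opt_value makespan J = 1"
    by (rule opt_value_attained[of J makespan]) (simp_all add: J one valid_rcmax_def[THEN iffD1, OF J])
  ultimately show ?thesis using one by simp
qed

text \<open>With \<open>V\<close> the scaled optimum, the threshold from \<open>ex_threshold\<close>
  has upper bound at most \<open>c * V + V\<close>. The bound of the returned schedule is no larger,
  and it dominates that schedule's scaled robust makespan.\<close>

lemma best_threshold_approx:
  assumes valid: "valid_robust I" and "c \<ge> 0"
    and S: "\<And>\<theta>. S \<theta> \<in> schedules I"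
      "\<And>\<theta>. real_of_rat (makespan (reduced I \<theta>) (S \<theta>)) \<le> c * real_of_rat (opt_value makespan (reduced I \<theta>))"
    and best: "\<And>k. k \<le> nmachs I * njobs I \<Longrightarrow> ubound I \<theta> (S \<theta>) \<le> ubound I (threshold I k) (S (threshold I k))"
  shows "real_of_rat (robust_makespan I (S \<theta>)) \<le> (c + 1) * real_of_rat (opt_value robust_makespan I)"
proof -
  have m: "nmachs I > 0" using valid by (simp add: valid_robust_def)
  obtain \<sigma> where \<sigma>: "\<sigma> \<in> schedules I" "opt_value robust_makespan I = robust_makespan I \<sigma>"
    using opt_value_attained[OF m] .
  define V where "V = of_nat (common_den I) * robust_makespan I \<sigma>"
  have "V \<ge> 0" unfolding V_def using robust_makespan_nonneg[OF valid] by simp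
  then obtain k where k: "k \<le> nmachs I * njobs I" "rat_of_nat (budget I * threshold I k) \<le> V"
    "\<And>i j. i < nmachs I \<Longrightarrow> j < njobs I \<Longrightarrow> threshold I k < dev I i j \<Longrightarrow> V < of_nat (budget I * dev I i j)"
    by (rule ex_threshold[where I = I]) blast
  let ?\<tau> = "threshold I k"
  have "opt_value makespan (reduced I ?\<tau>) \<le> makespan (reduced I ?\<tau>) \<sigma>"
    using \<sigma>(1) by (intro opt_value_le) simp
  also have "\<dots> \<le> V"
    unfolding V_def by (rule reduced_le_robust[OF valid]) (use k(3) V_def in blast)
  finally have "c * real_of_rat (opt_value makespan (reduced I ?\<tau>)) \<le> c * real_of_rat V"
    using \<open>c \<ge> 0\<close> by (intro mult_left_mono) (simp_all add: of_rat_less_eq)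
  with S(2)[of ?\<tau>] have *: "real_of_rat (makespan (reduced I ?\<tau>) (S ?\<tau>)) \<le> c * real_of_rat V"
    by linarith
  have "of_nat (common_den I) * robust_makespan I (S \<theta>) \<le> rat_of_nat (ubound I \<theta> (S \<theta>))"
    by (rule robust_le_ubound[OF valid])
  also have "\<dots> \<le> rat_of_nat (ubound I ?\<tau> (S ?\<tau>))" using best[OF k(1)] by simp
  also have "\<dots> \<le> makespan (reduced I ?\<tau>) (S ?\<tau>) + V"
    unfolding ubound_eq_makespan[OF m] using k(2) by simp
  finally have "real_of_rat (of_nat (common_den I) * robust_makespan I (S \<theta>))
      \<le> real_of_rat (makespan (reduced I ?\<tau>) (S ?\<tau>)) + real_of_rat V"
    by (metis of_rat_add of_rat_less_eq)
  also have "\<dots> \<le> (c + 1) * real_of_rat V" using * by (simp add: algebra_simps)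
  finally have "of_nat (common_den I) * real_of_rat (robust_makespan I (S \<theta>))
      \<le> of_nat (common_den I) * ((c + 1) * real_of_rat (robust_makespan I \<sigma>))"
    by (simp add: V_def of_rat_mult mult_ac)
  then show ?thesis using common_den_pos[of I] \<sigma>(2) by simp
qed

section \<open>Polynomial bounds\<close>

text \<open>Natural coefficients make every term monotone; this is what allows bounds to be
  composed.\<close>

lemma poly_nat_mono:
  fixes q :: "nat poly"
  assumes "a \<le> b"
  shows "poly q a \<le> poly q b"
  using assms by (induction q) (auto intro!: add_mono mult_mono)

text \<open>A context is a family of program inputs. The measure is kept apart from the inputs
  because inside a loop the input becomes the loop state, while costs are still counted against the
  original size.\<close>

datatype 'i ctx = Ctx (indices: "'i set") (msr: "'i \<Rightarrow> nat") (inp: "'i \<Rightarrow> data")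

definition pbounded :: "'i ctx \<Rightarrow> ('i \<Rightarrow> nat) \<Rightarrow> bool" where
  "pbounded C s \<longleftrightarrow> (\<exists>q :: nat poly. \<forall>i\<in>indices C. s i \<le> poly q (msr C i))"

text \<open>The index \<open>(i, k)\<close> stands for the state of run \<open>i\<close> before
  round \<open>k\<close>. A bound in this context is uniform in \<open>k\<close>, since the measure
  ignores the round.\<close>

definition iter :: "'i ctx \<Rightarrow> ('i \<Rightarrow> nat) \<Rightarrow> ('i \<Rightarrow> nat \<Rightarrow> data) \<Rightarrow> ('i \<times> nat) ctx" where
  "iter C T S = Ctx (SIGMA i:indices C. {..<T i}) (\<lambda>p. msr C (fst p)) (\<lambda>p. S (fst p) (snd p))"

abbreviation loop :: "'i ctx \<Rightarrow> ('i \<Rightarrow> nat) \<Rightarrow> ('i \<times> nat) ctx" where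
  "loop C n \<equiv> iter C n (\<lambda>i k. Node (inp C i) (Atom k))"

lemma iter_simps [simp]:
  "indices (iter C T S) = (SIGMA i:indices C. {..<T i})"
  "msr (iter C T S) p = msr C (fst p)"
  "inp (iter C T S) p = S (fst p) (snd p)"
  by (simp_all add: iter_def)

lemma pbounded_le:
  assumes "pbounded C s" and "\<And>i. i \<in> indices C \<Longrightarrow> r i \<le> s i"
  shows "pbounded C r"
  using assms unfolding pbounded_def by (meson order_trans)

lemma pbounded_const: "pbounded C (\<lambda>_. k)"
  unfolding pbounded_def by (rule exI[of _ "[:k:]"]) simp

lemma pbounded_add:
  assumes "pbounded C r" "pbounded C s"
  shows "pbounded C (\<lambda>i. r i + s i)"
proof -
  obtain q q' :: "nat poly" where "\<forall>i\<in>indices C. r i \<le> poly q (msr C i)" "\<forall>i\<in>indices C. s i \<le> poly q' (msr C i)"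
    using assms unfolding pbounded_def by blast
  then show ?thesis
    unfolding pbounded_def by (intro exI[of _ "q + q'"]) (auto intro: add_mono)
qed

lemma pbounded_mult:
  assumes "pbounded C r" "pbounded C s"
  shows "pbounded C (\<lambda>i. r i * s i)"
proof -
  obtain q q' :: "nat poly" where "\<forall>i\<in>indices C. r i \<le> poly q (msr C i)" "\<forall>i\<in>indices C. s i \<le> poly q' (msr C i)"
    using assms unfolding pbounded_def by blast
  then show ?thesis
    unfolding pbounded_def by (intro exI[of _ "q * q'"]) (auto intro: mult_mono)
qed

lemma pbounded_poly:
  assumes "pbounded C s"
  shows "pbounded C (\<lambda>i. poly q (s i))"
proof -
  obtain q' :: "nat poly" where "\<forall>i\<in>indices C. s i \<le> poly q' (msr C i)"
    using assms unfolding pbounded_def by blast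
  then show ?thesis
    unfolding pbounded_def
    by (intro exI[of _ "q \<circ>\<^sub>p q'"]) (auto simp: poly_pcompose intro: poly_nat_mono)
qed

lemma pbounded_iter:
  assumes "pbounded C s"
  shows "pbounded (iter C T S) (\<lambda>p. s (fst p))"
  using assms unfolding pbounded_def by fastforce

lemma pbounded_index:
  assumes "pbounded C T"
  shows "pbounded (iter C T S) snd"
  by (rule pbounded_le[OF pbounded_iter[OF assms]]) auto

text \<open>One polynomial bounds all summands of a run at once, so the number of summands times
  this polynomial bounds the sum.\<close>

lemma pbounded_sum:
  assumes n: "pbounded C n" and s: "pbounded (iter C n S) (\<lambda>p. s (fst p) (snd p))"
  shows "pbounded C (\<lambda>i. \<Sum>k<n i. s i k)"
proof -
  obtain q :: "nat poly" where q: "\<forall>p\<in>indices (iter C n S). s (fst p) (snd p) \<le> poly q (msr C (fst p))"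
    using s unfolding pbounded_def by auto
  have "pbounded C (\<lambda>i. n i * poly q (msr C i))"
    by (rule pbounded_mult[OF n]) (auto simp: pbounded_def)
  then show ?thesis
  proof (rule pbounded_le)
    fix i assume "i \<in> indices C"
    then have "s i k \<le> poly q (msr C i)" if "k < n i" for k
      using q that by auto
    then show "(\<Sum>k<n i. s i k) \<le> n i * poly q (msr C i)"
      using sum_bounded_above[of "{..<n i}" "s i" "poly q (msr C i)"] by simp
  qed
qed

text \<open>Scaled times can be exponentially large in the measure, so polynomial bounds are imposed
  on bit lengths instead of values.\<close>

definition small :: "'i ctx \<Rightarrow> ('i \<Rightarrow> nat) \<Rightarrow> bool" where
  "small C a \<longleftrightarrow> pbounded C (\<lambda>i. floorlog 2 (a i))"

lemma floorlog_le_of_less: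
  assumes "a < 2 ^ s"
  shows "floorlog 2 a \<le> s"
  using assms by (simp add: floorlog_le_iff)

lemma less_two_power_floorlog: "a < 2 ^ floorlog 2 a"
  using floorlog_le_iff[of 2 a "floorlog 2 a"] by simp

lemma floorlog_le_self: "floorlog 2 a \<le> a"
  by (rule floorlog_le_of_less) (rule less_exp)

lemma floorlog_mult_le: "floorlog 2 (a * b) \<le> floorlog 2 a + floorlog 2 b"
proof (rule floorlog_le_of_less)
  show "a * b < 2 ^ (floorlog 2 a + floorlog 2 b)"
    unfolding power_add by (intro mult_strict_mono' less_two_power_floorlog) simp_all
qed

lemma floorlog_add_le: "floorlog 2 (a + b) \<le> Suc (floorlog 2 a + floorlog 2 b)"
proof (rule floorlog_le_of_less)
  let ?s = "floorlog 2 a + floorlog 2 b"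
  have "a < 2 ^ ?s" "b < 2 ^ ?s"
    using less_two_power_floorlog[of a] less_two_power_floorlog[of b]
    by (meson le_add1 le_add2 less_le_trans one_le_numeral power_increasing)+
  then show "a + b < 2 ^ Suc ?s" by simp
qed

lemma small_le:
  assumes "small C b" and "\<And>i. i \<in> indices C \<Longrightarrow> a i \<le> b i"
  shows "small C a"
  using assms(1) unfolding small_def
  by (rule pbounded_le) (auto intro: floorlog_mono assms(2))

lemma small_pbounded: "pbounded C s \<Longrightarrow> small C s"
  unfolding small_def by (erule pbounded_le) (rule floorlog_le_self)

lemma small_const: "small C (\<lambda>_. k)"
  by (intro small_pbounded pbounded_const)

lemma small_add: "small C a \<Longrightarrow> small C b \<Longrightarrow> small C (\<lambda>i. a i + b i)"
  unfolding small_def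
  by (rule pbounded_le[OF pbounded_add[OF pbounded_const[of _ 1] pbounded_add]], assumption+)
    (simp add: floorlog_add_le)

lemma small_mult: "small C a \<Longrightarrow> small C b \<Longrightarrow> small C (\<lambda>i. a i * b i)"
  unfolding small_def
  by (rule pbounded_le[OF pbounded_add], assumption+) (rule floorlog_mult_le)

lemma small_div: "small C a \<Longrightarrow> small C (\<lambda>i. a i div b i)"
  by (erule small_le) (rule div_le_dividend)

lemma small_if: "small C a \<Longrightarrow> small C b \<Longrightarrow> small C (\<lambda>i. if c i then a i else b i)"
  by (rule small_le[OF small_add], assumption+) auto

lemma small_iter: "small C a \<Longrightarrow> small (iter C T S) (\<lambda>p. a (fst p))"
  unfolding small_def by (rule pbounded_iter)

text \<open>Bit lengths are subadditive under multiplication. The number of factors itself, not just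
  its bit length, has to be polynomial.\<close>

lemma small_prod:
  assumes n: "pbounded C n" and s: "small (iter C n S) (\<lambda>p. a (fst p) (snd p))"
  shows "small C (\<lambda>i. \<Prod>k<n i. a i k)"
proof -
  \<comment> \<open>The leading 1 is the bit length of the empty product.\<close>
  have "floorlog 2 (\<Prod>k<m. a i k) \<le> 1 + (\<Sum>k<m. floorlog 2 (a i k))" for i m
  proof (induction m)
    case (Suc m)
    show ?case using order_trans[OF floorlog_mult_le add_right_mono[OF Suc]] by simp
  qed (simp add: floorlog_def)
  then show ?thesis
    using pbounded_add[OF pbounded_const[of _ 1] pbounded_sum[OF n s[unfolded small_def]]]
    unfolding small_def by (auto elim: pbounded_le)
qed

lemma small_sum:
  assumes n: "pbounded C n" and s: "small (iter C n S) (\<lambda>p. a (fst p) (snd p))"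
  shows "small C (\<lambda>i. \<Sum>k<n i. a i k)"
proof -
  \<comment> \<open>Each addition may produce one carry bit, hence the 1 in every summand.\<close>
  have *: "floorlog 2 (\<Sum>k<m. a i k) \<le> (\<Sum>k<m. 1 + floorlog 2 (a i k))" for i m
  proof (induction m)
    case (Suc m)
    show ?case using order_trans[OF floorlog_add_le, of "\<Sum>k<m. a i k" "a i m"] Suc by simp
  qed (simp add: floorlog_def)
  have "pbounded (iter C n S) (\<lambda>p. 1 + floorlog 2 (a (fst p) (snd p)))"
    using s unfolding small_def by (intro pbounded_add pbounded_const)
  from pbounded_sum[OF n this] show ?thesis
    unfolding small_def using * by (auto elim: pbounded_le)
qed

section \<open>Families of values computable in polynomial time\<close>

text \<open>
  A single program must work for all indices in \<open>indices C\<close>, and \<open>msr C i\<close> is the quantity in which its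
  cost is polynomial. The sizes of values enter only through arithmetic, so that no bound on the
  size of \<open>y i\<close> is imposed.
\<close>

definition computable :: "'i ctx \<Rightarrow> ('i \<Rightarrow> data) \<Rightarrow> bool" where
  "computable C y \<longleftrightarrow> (\<exists>P t. pbounded C t \<and> (\<forall>i\<in>indices C. runs P (inp C i) (y i) (t i)))"

section \<open>Composition, arithmetic and branching\<close>

lemma computableI:
  assumes "pbounded C t" "\<And>i. i \<in> indices C \<Longrightarrow> runs P (inp C i) (y i) (t i)"
  shows "computable C y"
  using assms unfolding computable_def by blast

lemma computable_cong:
  assumes "computable C y" "\<And>i. i \<in> indices C \<Longrightarrow> y i = z i"
  shows "computable C z"
  using assms unfolding computable_def by auto

lemma computable_inp: "computable C (inp C)"
  by (rule computableI[OF pbounded_const]) (rule runs.Skip)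

lemma computable_lit: "computable C (\<lambda>_. Atom n)"
  by (rule computableI[OF pbounded_const]) (rule runs.Lit)

lemma pbounded_Ctx: "pbounded (Ctx (indices C) (msr C) y) s \<longleftrightarrow> pbounded C s"
  by (simp add: pbounded_def)

text \<open>The cost of the second program is bounded in the measure of \<open>C\<close>, not in the
  size of the intermediate value, so that size need not be controlled.\<close>

lemma computable_trans:
  assumes "computable C y" "computable (Ctx (indices C) (msr C) y) z"
  shows "computable C z"
proof -
  obtain P t Q u where "pbounded C t" "\<forall>i\<in>indices C. runs P (inp C i) (y i) (t i)"
    "pbounded C u" "\<forall>i\<in>indices C. runs Q (y i) (z i) (u i)"
    using assms unfolding computable_def by (auto simp: pbounded_Ctx)
  then show ?thesis
    by (intro computableI[of C "\<lambda>i. t i + u i + 1" "Seq P Q"] pbounded_add pbounded_const runs.Seq)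
      auto
qed

lemma computable_Node:
  assumes "computable C y" "computable C z"
  shows "computable C (\<lambda>i. Node (y i) (z i))"
proof -
  obtain P t Q u where "pbounded C t" "\<forall>i\<in>indices C. runs P (inp C i) (y i) (t i)"
    "pbounded C u" "\<forall>i\<in>indices C. runs Q (inp C i) (z i) (u i)"
    using assms unfolding computable_def by auto
  then show ?thesis
    by (intro computableI[of C "\<lambda>i. t i + u i + 1" "Fork P Q"] pbounded_add pbounded_const runs.Fork)
      auto
qed

lemma computable_left:
  assumes "computable C y"
  shows "computable C (\<lambda>i. left (y i))"
  using assms by (rule computable_trans) (rule computableI[OF pbounded_const], simp, rule runs.Fst)

lemma computable_right:
  assumes "computable C y"
  shows "computable C (\<lambda>i. right (y i))"
  using assms by (rule computable_trans) (rule computableI[OF pbounded_const], simp, rule runs.Snd)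

lemma computable_fst: "computable C (\<lambda>i. Node (y i) (z i)) \<Longrightarrow> computable C y"
  by (drule computable_left) simp

lemma computable_snd: "computable C (\<lambda>i. Node (y i) (z i)) \<Longrightarrow> computable C z"
  by (drule computable_right) simp

text \<open>The charge is the product of the operand sizes, which is why both operands must be
  small.\<close>

lemma computable_arith:
  assumes "computable C (\<lambda>i. Atom (a i))" "computable C (\<lambda>i. Atom (b i))" "small C a" "small C b"
  shows "computable C (\<lambda>i. Atom (arith_fun f (a i) (b i)))"
proof -
  have "pbounded C (\<lambda>i. (1 + floorlog 2 (a i)) * (1 + floorlog 2 (b i)))"
    using assms(3,4) unfolding small_def by (intro pbounded_mult pbounded_add pbounded_const)
  then have "computable (Ctx (indices C) (msr C) (\<lambda>i. Node (Atom (a i)) (Atom (b i))))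
      (\<lambda>i. Atom (arith_fun f (a i) (b i)))"
    using runs.Arith[of f "Node (Atom (a i)) (Atom (b i))" for i]
    by (intro computableI[where P = "Arith f"]) (simp_all add: pbounded_Ctx)
  with computable_Node[OF assms(1,2)] show ?thesis by (rule computable_trans)
qed

lemmas computable_add = computable_arith[where f = Add, simplified]
lemmas computable_sub = computable_arith[where f = Sub, simplified]
lemmas computable_mul = computable_arith[where f = Mul, simplified]
lemmas computable_div = computable_arith[where f = Div, simplified]

lemma computable_if_nonzero:
  assumes "computable C (\<lambda>i. Atom (c i))" "computable C y" "computable C z"
  shows "computable C (\<lambda>i. if c i \<noteq> 0 then y i else z i)"
proof -
  obtain B r P t Q u where "pbounded C r" "\<forall>i\<in>indices C. runs B (inp C i) (Atom (c i)) (r i)"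
    "pbounded C t" "\<forall>i\<in>indices C. runs P (inp C i) (y i) (t i)"
    "pbounded C u" "\<forall>i\<in>indices C. runs Q (inp C i) (z i) (u i)"
    using assms unfolding computable_def by auto
  note * = this
  have "pbounded C (\<lambda>i. r i + (if c i \<noteq> 0 then t i else u i) + 1)"
    by (rule pbounded_le[where s = "\<lambda>i. r i + (t i + u i) + 1", OF pbounded_add[OF pbounded_add[OF *(1) pbounded_add[OF *(3,5)]] pbounded_const]])
      auto
  then show ?thesis
  proof (rule computableI[where P = "Cond B P Q"])
    fix i assume i: "i \<in> indices C"
    show "runs (Cond B P Q) (inp C i) (if c i \<noteq> 0 then y i else z i)
        (r i + (if c i \<noteq> 0 then t i else u i) + 1)"
    proof (cases "c i = 0")
      case True
      with *(2) i have "runs B (inp C i) (Atom 0) (r i)" by metis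
      with *(6) i True show ?thesis using runs.Cond_false[of B "inp C i" "r i" Q "z i" "u i" P] by simp
    next
      case False
      with * i show ?thesis using runs.Cond_true[of B "inp C i" "Atom (c i)" "r i" P "y i" "t i" Q] by simp
    qed
  qed
qed

text \<open>The truncated difference \<open>b i - a i\<close> is nonzero exactly when
  \<open>a i < b i\<close>.\<close>

lemma computable_if_less:
  assumes "computable C (\<lambda>i. Atom (a i))" "computable C (\<lambda>i. Atom (b i))" "small C a" "small C b"
    and "computable C y" "computable C z"
  shows "computable C (\<lambda>i. if a i < b i then y i else z i)"
  by (rule computable_cong[OF computable_if_nonzero[OF computable_sub[OF assms(2,1,4,3)] assms(5,6)]]) auto

text \<open>Equality is tested by the failure of both strict comparisons.\<close>

lemma computable_if_eq:
  assumes "computable C (\<lambda>i. Atom (a i))" "computable C (\<lambda>i. Atom (b i))" "small C a" "small C b"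
    and "computable C y" "computable C z"
  shows "computable C (\<lambda>i. if a i = b i then y i else z i)"
  by (rule computable_cong[OF computable_if_less[OF assms(1-4) assms(6)
          computable_if_less[OF assms(2,1,4,3) assms(6,5)]]]) auto

text \<open>The same program is run on the input belonging to another index of equal measure. This
  carries loop-invariant values into loops and also permits running through a list
  backwards.\<close>

lemma computable_reindex:
  assumes "computable C y" "computable D (\<lambda>p. inp C (h p))"
    and "\<And>p. p \<in> indices D \<Longrightarrow> h p \<in> indices C \<and> msr C (h p) = msr D p"
  shows "computable D (\<lambda>p. y (h p))"
proof (rule computable_trans[OF assms(2)])
  obtain P t where t: "pbounded C t" "\<forall>i\<in>indices C. runs P (inp C i) (y i) (t i)"
    using assms(1) unfolding computable_def by auto
  have "pbounded D (\<lambda>p. t (h p))"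
    using t(1) assms(3) unfolding pbounded_def by metis
  then show "computable (Ctx (indices D) (msr D) (\<lambda>p. inp C (h p))) (\<lambda>p. y (h p))"
    by (intro computableI[where P = P]) (use t assms(3) in \<open>auto simp: pbounded_Ctx\<close>)
qed

lemma computable_iter:
  assumes "computable C y" "computable (iter C T S) (\<lambda>p. inp C (fst p))"
  shows "computable (iter C T S) (\<lambda>p. y (fst p))"
  using assms by (rule computable_reindex) auto

text \<open>\<open>S i k\<close> is the state after \<open>k\<close> rounds. The test has a larger
  context than the body because it is also evaluated on the final state.\<close>

lemma computable_while:
  assumes start: "computable C (\<lambda>i. S i 0)"
    and step: "computable (iter C T S) (\<lambda>p. S (fst p) (Suc (snd p)))"
    and test: "computable (iter C (\<lambda>i. Suc (T i)) S) (\<lambda>p. B (fst p) (snd p))"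
    and T: "pbounded C T"
    and nz: "\<And>i k. i \<in> indices C \<Longrightarrow> k < T i \<Longrightarrow> B i k \<noteq> Atom 0"
    and z: "\<And>i. i \<in> indices C \<Longrightarrow> B i (T i) = Atom 0"
  shows "computable C (\<lambda>i. S i (T i))"
proof (rule computable_trans[OF start])
  obtain P t where t: "pbounded (iter C T S) t"
    "\<forall>p\<in>indices (iter C T S). runs P (S (fst p) (snd p)) (S (fst p) (Suc (snd p))) (t p)"
    using step unfolding computable_def by auto
  obtain Q u where u: "pbounded (iter C (\<lambda>i. Suc (T i)) S) u"
    "\<forall>p\<in>indices (iter C (\<lambda>i. Suc (T i)) S). runs Q (S (fst p) (snd p)) (B (fst p) (snd p)) (u p)"
    using test unfolding computable_def by auto
  have P: "runs P (S i k) (S i (Suc k)) (t (i, k))" if "i \<in> indices C" "k < T i" for i k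
    using t(2) that by auto
  have Q: "runs Q (S i k) (B i k) (u (i, k))" if "i \<in> indices C" "k \<le> T i" for i k
    using u(2) that by auto
  let ?W = "While Q P"
  \<comment> \<open>Induction on the number \<open>k\<close> of remaining rounds, because the rule
    for \<open>While\<close> unfolds the first round.\<close>
  have W: "runs ?W (S i (T i - k)) (S i (T i))
      ((\<Sum>l\<in>{T i - k..<T i}. u (i, l) + t (i, l) + 1) + u (i, T i) + 1)"
    if i: "i \<in> indices C" and "k \<le> T i" for i k
    using that(2)
  proof (induction k)
    case 0
    show ?case using runs.While_false[of Q "S i (T i)" "u (i, T i)" P] Q[OF i, of "T i"] z[OF i] by simp
  next
    case (Suc k)
    let ?l = "T i - Suc k"
    have l: "Suc ?l = T i - k" "?l < T i" using Suc.prems by auto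
    have "runs ?W (S i ?l) (S i (T i)) (u (i, ?l) + t (i, ?l)
        + ((\<Sum>l\<in>{T i - k..<T i}. u (i, l) + t (i, l) + 1) + u (i, T i) + 1) + 1)"
      using Suc P[OF i l(2)] Q[OF i, of ?l] nz[OF i l(2)] l
      by (intro runs.While_true) auto
    moreover have "{?l..<T i} = insert ?l {T i - k..<T i}" using l by auto
    ultimately show ?case using l by (simp add: algebra_simps)
  qed
  have "pbounded C (\<lambda>i. (\<Sum>l<T i. u (i, l) + t (i, l) + 1) + u (i, T i) + 1)"
  proof (intro pbounded_add pbounded_const)
    \<comment> \<open>The rounds form a subset of the indices on which the test is bounded.\<close>
    have "pbounded (iter C T S) u"
      using u(1) unfolding pbounded_def by (elim ex_forward) auto
    with t(1) have "pbounded (iter C T S) (\<lambda>p. u (fst p, snd p) + t (fst p, snd p) + 1)"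
      by (intro pbounded_add pbounded_const) simp_all
    then show "pbounded C (\<lambda>i. \<Sum>l<T i. u (i, l) + t (i, l) + 1)"
      by (rule pbounded_sum[OF T, where s = "\<lambda>i l. u (i, l) + t (i, l) + 1"])
    show "pbounded C (\<lambda>i. u (i, T i))"
      using u(1) unfolding pbounded_def by force
  qed
  then show "computable (Ctx (indices C) (msr C) (\<lambda>i. S i 0)) (\<lambda>i. S i (T i))"
    by (intro computableI[where P = ?W]) (use W in \<open>force simp: pbounded_Ctx lessThan_atLeast0\<close>)+
qed

lemma computable_for:
  assumes n: "computable C (\<lambda>i. Atom (n i))" "pbounded C n"
    and start: "computable C (\<lambda>i. A i 0)"
    and step: "computable (iter C n (\<lambda>i k. Node (inp C i) (Node (Atom k) (A i k)))) (\<lambda>p. A (fst p) (Suc (snd p)))"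
  shows "computable C (\<lambda>i. A i (n i))"
proof -
  let ?S = "\<lambda>i k. Node (inp C i) (Node (Atom k) (A i k))"
  have S: "computable (iter C T ?S) (\<lambda>p. inp C (fst p))" "computable (iter C T ?S) (\<lambda>p. Atom (snd p))" for T
  proof -
    have "computable (iter C T ?S) (\<lambda>p. ?S (fst p) (snd p))"
      by (rule computable_cong[OF computable_inp]) simp
    from computable_fst[OF this] computable_fst[OF computable_snd[OF this]]
    show "computable (iter C T ?S) (\<lambda>p. inp C (fst p))" "computable (iter C T ?S) (\<lambda>p. Atom (snd p))" .
  qed
  \<comment> \<open>The state holds input, counter and accumulator. The test recomputes
    \<open>n i\<close> from the input and subtracts the counter, giving 0 exactly at the
    end.\<close>
  have "computable C (\<lambda>i. ?S i (n i))"
  proof (rule computable_while[where B = "\<lambda>i k. Atom (n i - k)"])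
    show "computable C (\<lambda>i. ?S i 0)"
      by (intro computable_Node computable_lit start computable_inp)
    have "small (iter C n ?S) snd"
      by (intro small_pbounded pbounded_index n)
    from computable_add[OF S(2) computable_lit[of _ 1] this small_const]
    show "computable (iter C n ?S) (\<lambda>p. ?S (fst p) (Suc (snd p)))"
      by (intro computable_Node S step) simp
    let ?C = "iter C (\<lambda>i. Suc (n i)) ?S"
    have "pbounded C (\<lambda>i. 1 + n i)" by (intro pbounded_add pbounded_const n)
    then have "small ?C snd"
      by (intro small_pbounded pbounded_index) (simp only: plus_1_eq_Suc)
    then show "computable ?C (\<lambda>p. Atom (n (fst p) - snd p))"
      by (intro computable_sub computable_iter[OF n(1)] S small_iter[OF small_pbounded[OF n(2)]])
  qed (use n(2) in auto)
  from computable_snd[OF computable_snd[OF this]] show ?thesis .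
qed

lemma computable_loop_inp: "computable (loop C n) (\<lambda>p. inp C (fst p))"
  and computable_index: "computable (loop C n) (\<lambda>p. Atom (snd p))"
proof -
  have "computable (loop C n) (\<lambda>p. Node (inp C (fst p)) (Atom (snd p)))"
    by (rule computable_cong[OF computable_inp]) simp
  from computable_fst[OF this] computable_snd[OF this]
  show "computable (loop C n) (\<lambda>p. inp C (fst p))" "computable (loop C n) (\<lambda>p. Atom (snd p))" .
qed

lemmas computable_loop = computable_iter[OF _ computable_loop_inp]

text \<open>The step is stated for every context \<open>D\<close> with the indices and measure of
  the loop. It may thus use accumulator, current item, input and counter without reference to how
  they are laid out in the loop state.\<close>

lemma computable_fold:
  assumes n: "computable C (\<lambda>i. Atom (n i))" "pbounded C n"
    and start: "computable C (\<lambda>i. A i 0)"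
    and f: "computable (loop C n) (\<lambda>p. f (fst p) (snd p))"
    and step: "\<And>D :: ('a \<times> nat) ctx. indices D = indices (loop C n) \<Longrightarrow> msr D = msr (loop C n)
      \<Longrightarrow> computable D (\<lambda>p. A (fst p) (snd p)) \<Longrightarrow> computable D (\<lambda>p. f (fst p) (snd p))
      \<Longrightarrow> computable D (\<lambda>p. inp C (fst p)) \<Longrightarrow> computable D (\<lambda>p. Atom (snd p))
      \<Longrightarrow> computable D (\<lambda>p. A (fst p) (Suc (snd p)))"
  shows "computable C (\<lambda>i. A i (n i))"
proof (rule computable_for[where A = A, OF n start])
  let ?D = "iter C n (\<lambda>i k. Node (inp C i) (Node (Atom k) (A i k)))"
  have S: "computable ?D (\<lambda>p. Node (inp C (fst p)) (Node (Atom (snd p)) (A (fst p) (snd p))))"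
    by (rule computable_cong[OF computable_inp]) simp
  note inp = computable_fst[OF S] and idx = computable_fst[OF computable_snd[OF S]] and acc = computable_snd[OF computable_snd[OF S]]
  have "computable ?D (\<lambda>p. f (fst p) (snd p))"
    by (rule computable_trans[OF computable_Node[OF inp idx]]) (use f in \<open>simp add: iter_def\<close>)
  then show "computable ?D (\<lambda>p. A (fst p) (Suc (snd p)))"
    by (intro step inp idx acc) (simp_all add: iter_def)
qed

section \<open>Sums, products, maxima, lists and minimisation by loops\<close>

lemma small_ctx_cong:
  assumes "indices D = indices C" "msr D = msr C"
  shows "small D a \<longleftrightarrow> small C a"
  using assms by (simp add: small_def pbounded_def)

lemma computable_sum:
  assumes n: "computable C (\<lambda>i. Atom (n i))" "pbounded C n"
    and f: "computable (loop C n) (\<lambda>p. Atom (f (fst p) (snd p)))" "small (loop C n) (\<lambda>p. f (fst p) (snd p))"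
  shows "computable C (\<lambda>i. Atom (\<Sum>k<n i. f i k))"
proof (rule computable_fold[where A = "\<lambda>i k. Atom (\<Sum>l<k. f i l)", OF n _ f(1)])
  fix D :: "('a \<times> nat) ctx"
  assume D: "indices D = indices (loop C n)" "msr D = msr (loop C n)"
    and c: "computable D (\<lambda>p. Atom (\<Sum>l<snd p. f (fst p) l))" "computable D (\<lambda>p. Atom (f (fst p) (snd p)))"
  \<comment> \<open>The accumulator stays small because partial sums are below the whole
    sum.\<close>
  have "small (loop C n) (\<lambda>p. \<Sum>l<snd p. f (fst p) l)"
    by (rule small_le[OF small_iter[OF small_sum[OF n(2) f(2)]]]) (auto intro!: sum_mono2)
  with f(2) have "computable D (\<lambda>p. Atom ((\<Sum>l<snd p. f (fst p) l) + f (fst p) (snd p)))"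
    by (intro computable_add c) (simp_all add: small_ctx_cong[OF D])
  then show "computable D (\<lambda>p. Atom (\<Sum>l<Suc (snd p). f (fst p) l))" by simp
qed (simp add: computable_lit)

text \<open>Positivity makes each partial product a divisor of a positive number, the whole product,
  hence at most as large; this keeps the accumulator small.\<close>

lemma computable_prod:
  assumes n: "computable C (\<lambda>i. Atom (n i))" "pbounded C n"
    and f: "computable (loop C n) (\<lambda>p. Atom (f (fst p) (snd p)))" "small (loop C n) (\<lambda>p. f (fst p) (snd p))"
    and pos: "\<And>i k. i \<in> indices C \<Longrightarrow> k < n i \<Longrightarrow> f i k > 0"
  shows "computable C (\<lambda>i. Atom (\<Prod>k<n i. f i k))"
proof (rule computable_fold[where A = "\<lambda>i k. Atom (\<Prod>l<k. f i l)", OF n _ f(1)])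
  fix D :: "('a \<times> nat) ctx"
  assume D: "indices D = indices (loop C n)" "msr D = msr (loop C n)"
    and c: "computable D (\<lambda>p. Atom (\<Prod>l<snd p. f (fst p) l))" "computable D (\<lambda>p. Atom (f (fst p) (snd p)))"
  have "small (loop C n) (\<lambda>p. \<Prod>l<snd p. f (fst p) l)"
  proof (rule small_le[OF small_iter[OF small_prod[OF n(2) f(2)]]])
    fix p assume "p \<in> indices (loop C n)"
    then show "(\<Prod>l<snd p. f (fst p) l) \<le> (\<Prod>l<n (fst p). f (fst p) l)"
      using pos by (intro dvd_imp_le prod_dvd_prod_subset prod_pos) auto
  qed
  with f(2) have "computable D (\<lambda>p. Atom ((\<Prod>l<snd p. f (fst p) l) * f (fst p) (snd p)))"
    by (intro computable_mul c) (simp_all add: small_ctx_cong[OF D])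
  then show "computable D (\<lambda>p. Atom (\<Prod>l<Suc (snd p). f (fst p) l))" by simp
qed (simp add: computable_lit)

text \<open>The inserted 0 is the initial accumulator. The sum of all values serves as a crude bound
  on the running maximum.\<close>

lemma computable_Max:
  fixes f :: "'a \<Rightarrow> nat \<Rightarrow> nat"
  assumes n: "computable C (\<lambda>i. Atom (n i))" "pbounded C n"
    and f: "computable (loop C n) (\<lambda>p. Atom (f (fst p) (snd p)))" "small (loop C n) (\<lambda>p. f (fst p) (snd p))"
  shows "computable C (\<lambda>i. Atom (Max (insert 0 (f i ` {..<n i}))))"
proof (rule computable_fold[where A = "\<lambda>i k. Atom (Max (insert 0 (f i ` {..<k})))", OF n _ f(1)])
  fix D :: "('a \<times> nat) ctx"
  assume D: "indices D = indices (loop C n)" "msr D = msr (loop C n)"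
    and c: "computable D (\<lambda>p. Atom (Max (insert 0 (f (fst p) ` {..<snd p}))))"
      "computable D (\<lambda>p. Atom (f (fst p) (snd p)))"
  have le: "Max (insert 0 (f i ` {..<k})) \<le> (\<Sum>l<n i. f i l)" if "k \<le> n i" for i k
    using that by (intro Max.boundedI) (auto intro: member_le_sum)
  have "small (loop C n) (\<lambda>p. Max (insert 0 (f (fst p) ` {..<snd p})))"
    by (rule small_le[OF small_iter[OF small_sum[OF n(2) f(2)]]]) (rule le, auto)
  with f(2) have "computable D (\<lambda>p. if Max (insert 0 (f (fst p) ` {..<snd p})) < f (fst p) (snd p)
      then Atom (f (fst p) (snd p)) else Atom (Max (insert 0 (f (fst p) ` {..<snd p}))))"
    by (intro computable_if_less c) (simp_all add: small_ctx_cong[OF D])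
  moreover have if_max: "(if a < b then Atom b else Atom a) = Atom (max b a)" for a b :: nat
    by (simp add: max_def)
  moreover have "Max (insert 0 (f i ` {..<Suc k})) = max (f i k) (Max (insert 0 (f i ` {..<k})))" for i k
    by (simp add: lessThan_Suc insert_commute[of 0])
  ultimately show "computable D (\<lambda>p. Atom (Max (insert 0 (f (fst p) ` {..<Suc (snd p)}))))"
    by (simp only:)
qed (simp add: computable_lit)

text \<open>\<open>Node\<close> extends a list at the front, so the list is built from its end:
  round \<open>k\<close> prepends entry \<open>n i - Suc k\<close>.\<close>

lemma computable_list:
  assumes n: "computable C (\<lambda>i. Atom (n i))" "pbounded C n"
    and f: "computable (loop C n) (\<lambda>p. f (fst p) (snd p))"
  shows "computable C (\<lambda>i. enc_list (f i) [0..<n i])"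
proof -
  have small: "small (loop C n) snd" "small (loop C n) (\<lambda>p. n (fst p))"
    by (intro small_pbounded pbounded_index pbounded_iter n(2))+
  have "computable (loop C n) (\<lambda>p. Atom (n (fst p) - (snd p + 1)))"
    using computable_loop[OF n(1)] small
    by (intro computable_sub computable_add computable_index computable_lit small_add small_const)
  with computable_loop_inp have "computable (loop C n)
      (\<lambda>p. inp (loop C n) (fst p, n (fst p) - Suc (snd p)))"
    unfolding iter_simps by (intro computable_Node) simp_all
  from computable_reindex[OF f this]
  have f': "computable (loop C n) (\<lambda>p. f (fst p) (n (fst p) - Suc (snd p)))" by auto
  \<comment> \<open>The lower end is left as \<open>n i - n i\<close> to match the accumulator after
    \<open>n i\<close> rounds.\<close>
  have "computable C (\<lambda>i. enc_list (f i) [n i - n i..<n i])"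
  proof (rule computable_fold[where A = "\<lambda>i k. enc_list (f i) [n i - k..<n i]", OF n _ f'])
    fix D :: "('a \<times> nat) ctx"
    assume D: "indices D = indices (loop C n)"
      and c: "computable D (\<lambda>p. enc_list (f (fst p)) [n (fst p) - snd p..<n (fst p)])"
        "computable D (\<lambda>p. f (fst p) (n (fst p) - Suc (snd p)))"
    have "[n i - Suc k..<n i] = (n i - Suc k) # [n i - k..<n i]" if "k < n i" for i k
      using that by (subst upt_conv_Cons) (auto simp: Suc_diff_Suc)
    then show "computable D (\<lambda>p. enc_list (f (fst p)) [n (fst p) - Suc (snd p)..<n (fst p)])"
      by (intro computable_cong[OF computable_Node[OF c(2,1)]]) (auto simp: D)
  qed (simp add: computable_lit)
  then show ?thesis by simp
qed

text \<open>The tail is taken \<open>k i\<close> times and then the head. The loop body reads only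
  the accumulator, so the item of each round is the dummy \<open>Atom 0\<close>.\<close>

lemma computable_nth:
  assumes "computable C (\<lambda>i. enc_list (f i) [0..<n i])"
    and k: "computable C (\<lambda>i. Atom (k i))" "pbounded C k" "\<And>i. i \<in> indices C \<Longrightarrow> k i < n i"
  shows "computable C (\<lambda>i. f i (k i))"
proof -
  have upt: "[l..<n i] = l # [Suc l..<n i]" if "l \<le> k i" "i \<in> indices C" for i l
    using that k(3)[of i] by (intro upt_conv_Cons) simp
  have "computable C (\<lambda>i. enc_list (f i) [k i..<n i])"
  proof (rule computable_fold[where A = "\<lambda>i l. enc_list (f i) [l..<n i]", OF k(1,2) assms(1) computable_lit[of _ 0]])
    fix D :: "('a \<times> nat) ctx"
    assume D: "indices D = indices (loop C k)"
      and "computable D (\<lambda>p. enc_list (f (fst p)) [snd p..<n (fst p)])"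
    from computable_right[OF this(2)]
    show "computable D (\<lambda>p. enc_list (f (fst p)) [Suc (snd p)..<n (fst p)])"
      by (rule computable_cong) (auto simp: D upt)
  qed
  from computable_left[OF this] show ?thesis
    by (rule computable_cong) (auto simp: upt)
qed

primrec argmin_upto :: "(nat \<Rightarrow> 'a :: linorder) \<Rightarrow> nat \<Rightarrow> nat" where
  "argmin_upto f 0 = 0"
| "argmin_upto f (Suc k) = (if f (Suc k) < f (argmin_upto f k) then Suc k else argmin_upto f k)"

lemma argmin_upto_least: "l \<le> k \<Longrightarrow> f (argmin_upto f k) \<le> f l"
  by (induction k) (auto simp: le_Suc_eq)

text \<open>The accumulator holds the best \<open>y\<close> together with its value
  \<open>f\<close>, so nothing is recomputed and the size of \<open>y\<close> is irrelevant.
  Candidate 0 starts the loop and round \<open>k\<close> examines candidate \<open>Suc k\<close>, as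
  in the cases of \<open>threshold\<close>.\<close>

lemma computable_argmin_upto:
  assumes n: "computable C (\<lambda>i. Atom (n i))" "pbounded C n"
    and f0: "computable C (\<lambda>i. Atom (f i 0))" "small C (\<lambda>i. f i 0)"
    and f: "computable (loop C n) (\<lambda>p. Atom (f (fst p) (Suc (snd p))))"
      "small (loop C n) (\<lambda>p. f (fst p) (Suc (snd p)))"
    and y0: "computable C (\<lambda>i. y i 0)"
    and y: "computable (loop C n) (\<lambda>p. y (fst p) (Suc (snd p)))"
  shows "computable C (\<lambda>i. y i (argmin_upto (f i) (n i)))"
proof -
  let ?B = "\<lambda>i k. Node (y i k) (Atom (f i k))"
  let ?A = "\<lambda>i k. ?B i (argmin_upto (f i) k)"
  have bound: "small C (\<lambda>i. f i 0 + (\<Sum>k<n i. f i (Suc k)))"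
    by (intro small_add f0 small_sum[OF n(2) f(2)])
  have le: "f i (argmin_upto (f i) k) \<le> f i 0 + (\<Sum>k<n i. f i (Suc k))" for i k
    by (rule trans_le_add1) (rule argmin_upto_least, simp)
  have "computable C (\<lambda>i. ?A i (n i))"
  proof (rule computable_fold[where A = ?A and f = "\<lambda>i k. ?B i (Suc k)", OF n _ computable_Node[OF y f(1)]])
    fix D :: "('a \<times> nat) ctx"
    assume D: "indices D = indices (loop C n)" "msr D = msr (loop C n)"
      and c: "computable D (\<lambda>p. ?A (fst p) (snd p))" "computable D (\<lambda>p. ?B (fst p) (Suc (snd p)))"
    have "small (loop C n) (\<lambda>p. f (fst p) (argmin_upto (f (fst p)) (snd p)))"
      by (rule small_le[OF small_iter[OF bound]]) (rule le)
    with f(2) have "computable D (\<lambda>p. if f (fst p) (Suc (snd p)) < f (fst p) (argmin_upto (f (fst p)) (snd p))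
        then ?B (fst p) (Suc (snd p)) else ?A (fst p) (snd p))"
      by (intro computable_if_less c computable_snd[OF c(1)] computable_snd[OF c(2)])
        (simp_all add: small_ctx_cong[OF D])
    then show "computable D (\<lambda>p. ?A (fst p) (Suc (snd p)))"
      by (rule computable_cong) simp
  qed (simp add: computable_Node f0 y0)
  from computable_fst[OF this] show ?thesis .
qed

lemma pbounded_enc_list:
  assumes "pbounded C n" "pbounded (loop C n) (\<lambda>p. data_size (f (fst p) (snd p)))"
  shows "pbounded C (\<lambda>i. data_size (enc_list (f i) [0..<n i]))"
proof -
  have "data_size (enc_list (f i) xs) = 1 + (\<Sum>x\<leftarrow>xs. 1 + data_size (f i x))" for i and xs
    by (induction xs) (simp_all add: floorlog_def)
  then have "data_size (enc_list (f i) [0..<m]) = 1 + (\<Sum>k<m. 1 + data_size (f i k))" for i m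
    by (simp add: interv_sum_list_conv_sum_set_nat lessThan_atLeast0)
  moreover have "pbounded (loop C n) (\<lambda>p. 1 + data_size (f (fst p) (snd p)))"
    using assms(2) by (intro pbounded_add pbounded_const)
  ultimately show ?thesis
    using pbounded_add[OF pbounded_const[of C 1] pbounded_sum[OF assms(1)]] by fastforce
qed

section \<open>The reduction in polynomial time\<close>

lemma data_size_enc_list_ge:
  assumes "x \<in> set xs"
  shows "data_size (f x) \<le> data_size (enc_list f xs)"
  using assms by (induction xs) auto

lemma length_le_data_size_enc_list: "length xs \<le> data_size (enc_list f xs)"
  by (induction xs) auto

text \<open>The numbers of machines and jobs are written in binary, so their values are bounded
  through the matrix instead. For the number of jobs this takes a row, hence \<open>i < m\<close>;
  validity of an instance supplies one.\<close>

lemma data_size_enc_matrix: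
  assumes "i < m"
  shows "m \<le> data_size (enc_matrix m n p)" "n \<le> data_size (enc_matrix m n p)"
    "j < n \<Longrightarrow> data_size (enc_rat (p i j)) \<le> data_size (enc_matrix m n p)"
proof -
  let ?row = "enc_list (\<lambda>j. enc_rat (p i j)) [0..<n]"
  show "m \<le> data_size (enc_matrix m n p)"
    unfolding enc_matrix_def using length_le_data_size_enc_list[of "[0..<m]"] by simp
  have row: "data_size ?row \<le> data_size (enc_matrix m n p)"
    unfolding enc_matrix_def using assms by (intro data_size_enc_list_ge) auto
  then show "n \<le> data_size (enc_matrix m n p)"
    using length_le_data_size_enc_list[of "[0..<n]"] order_trans by fastforce
  show "data_size (enc_rat (p i j)) \<le> data_size (enc_matrix m n p)" if "j < n"
    using row that by (intro order_trans[OF data_size_enc_list_ge row]) auto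
qed

lemma computable_matrix_entry:
  assumes "computable C (\<lambda>i. enc_matrix (m i) (n i) (p i))"
    and r: "computable C (\<lambda>i. Atom (r i))" "pbounded C r" "\<And>i. i \<in> indices C \<Longrightarrow> r i < m i"
    and c: "computable C (\<lambda>i. Atom (c i))" "pbounded C c" "\<And>i. i \<in> indices C \<Longrightarrow> c i < n i"
  shows "computable C (\<lambda>i. Atom (rnum (p i (r i) (c i))))" "computable C (\<lambda>i. Atom (rden (p i (r i) (c i))))"
proof -
  have "computable C (\<lambda>i. enc_list (\<lambda>j. enc_rat (p i (r i) j)) [0..<n i])"
    by (rule computable_nth[where f = "\<lambda>i r. enc_list (\<lambda>j. enc_rat (p i r j)) [0..<n i]",
          OF assms(1)[unfolded enc_matrix_def] r])
  from computable_nth[where f = "\<lambda>i j. enc_rat (p i (r i) j)", OF this c]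
  have e: "computable C (\<lambda>i. Node (Atom (rnum (p i (r i) (c i)))) (Atom (rden (p i (r i) (c i)))))"
    by (simp add: enc_rat_eq)
  from computable_fst[OF e] computable_snd[OF e]
  show "computable C (\<lambda>i. Atom (rnum (p i (r i) (c i))))" "computable C (\<lambda>i. Atom (rden (p i (r i) (c i))))" .
qed

lemma small_matrix_entry:
  assumes "pbounded C (\<lambda>i. data_size (enc_matrix (m i) (n i) (p i)))"
    and "\<And>i. i \<in> indices C \<Longrightarrow> r i < m i" "\<And>i. i \<in> indices C \<Longrightarrow> c i < n i"
  shows "small C (\<lambda>i. rnum (p i (r i) (c i)))" "small C (\<lambda>i. rden (p i (r i) (c i)))"
proof -
  have e: "data_size (enc_rat (p i (r i) (c i))) \<le> data_size (enc_matrix (m i) (n i) (p i))"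
    if "i \<in> indices C" for i
    using that assms by (intro data_size_enc_matrix(3))
  show "small C (\<lambda>i. rnum (p i (r i) (c i)))" "small C (\<lambda>i. rden (p i (r i) (c i)))"
    unfolding small_def
    by (rule pbounded_le[OF assms(1)], drule e, simp add: enc_rat_eq)+
qed

text \<open>Stated for a family \<open>I\<close> of instances over arbitrary indices, so that it
  persists in nested loops, where \<open>I\<close> is composed with \<open>fst\<close>.\<close>

definition robust_input :: "'i ctx \<Rightarrow> ('i \<Rightarrow> robust_instance) \<Rightarrow> bool" where
  "robust_input C I \<longleftrightarrow> computable C (\<lambda>i. enc_robust (I i)) \<and>
    pbounded C (\<lambda>i. data_size (enc_robust (I i))) \<and> (\<forall>i\<in>indices C. valid_robust (I i))"

lemma robust_input_loop:
  "robust_input C I \<Longrightarrow> robust_input (loop C n) (\<lambda>p. I (fst p))"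
  unfolding robust_input_def by (auto intro: computable_loop pbounded_iter)

text \<open>The numbers of jobs and machines may serve as loop bounds. The budget is only small: its
  value can be exponential, but it occurs in arithmetic and never as a number of rounds.\<close>

lemma
  assumes "robust_input C I"
  shows computable_njobs: "computable C (\<lambda>i. Atom (njobs (I i)))"
    and computable_nmachs: "computable C (\<lambda>i. Atom (nmachs (I i)))"
    and computable_budget: "computable C (\<lambda>i. Atom (budget (I i)))"
    and computable_nominal: "computable C (\<lambda>i. enc_matrix (nmachs (I i)) (njobs (I i)) (nominal (I i)))"
    and computable_deviation: "computable C (\<lambda>i. enc_matrix (nmachs (I i)) (njobs (I i)) (deviation (I i)))"
    and pbounded_nominal: "pbounded C (\<lambda>i. data_size (enc_matrix (nmachs (I i)) (njobs (I i)) (nominal (I i))))"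
    and pbounded_deviation: "pbounded C (\<lambda>i. data_size (enc_matrix (nmachs (I i)) (njobs (I i)) (deviation (I i))))"
    and pbounded_njobs: "pbounded C (\<lambda>i. njobs (I i))"
    and pbounded_nmachs: "pbounded C (\<lambda>i. nmachs (I i))"
    and small_budget: "small C (\<lambda>i. budget (I i))"
proof -
  have e: "computable C (\<lambda>i. enc_robust (I i))" and s: "pbounded C (\<lambda>i. data_size (enc_robust (I i)))"
    and v: "\<And>i. i \<in> indices C \<Longrightarrow> 0 < nmachs (I i)"
    using assms by (auto simp: robust_input_def valid_robust_def)
  show "computable C (\<lambda>i. Atom (njobs (I i)))"
    using computable_left[OF e] by (simp add: enc_robust_def)
  show "computable C (\<lambda>i. Atom (nmachs (I i)))"
    using computable_left[OF computable_right[OF e]] by (simp add: enc_robust_def)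
  show "computable C (\<lambda>i. Atom (budget (I i)))"
    using computable_left[OF computable_right[OF computable_right[OF e]]] by (simp add: enc_robust_def)
  show "computable C (\<lambda>i. enc_matrix (nmachs (I i)) (njobs (I i)) (nominal (I i)))"
    using computable_left[OF computable_right[OF computable_right[OF computable_right[OF e]]]]
    by (simp add: enc_robust_def)
  show "computable C (\<lambda>i. enc_matrix (nmachs (I i)) (njobs (I i)) (deviation (I i)))"
    using computable_right[OF computable_right[OF computable_right[OF computable_right[OF e]]]]
    by (simp add: enc_robust_def)
  show "small C (\<lambda>i. budget (I i))"
    unfolding small_def by (rule pbounded_le[OF s]) (simp add: enc_robust_def)
  show nominal: "pbounded C (\<lambda>i. data_size (enc_matrix (nmachs (I i)) (njobs (I i)) (nominal (I i))))"
    by (rule pbounded_le[OF s]) (simp add: enc_robust_def)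
  show "pbounded C (\<lambda>i. data_size (enc_matrix (nmachs (I i)) (njobs (I i)) (deviation (I i))))"
    by (rule pbounded_le[OF s]) (simp add: enc_robust_def)
  show "pbounded C (\<lambda>i. njobs (I i))" "pbounded C (\<lambda>i. nmachs (I i))"
    by (rule pbounded_le[OF nominal], rule data_size_enc_matrix, erule v)+
qed

lemma
  assumes R: "robust_input C I"
  shows computable_common_den: "computable C (\<lambda>i. Atom (common_den (I i)))"
    and small_common_den: "small C (\<lambda>i. common_den (I i))"
proof -
  let ?C1 = "loop C (\<lambda>i. nmachs (I i))"
  \<comment> \<open>An index of \<open>?C2\<close> has the form \<open>((i, r), j)\<close> with
    instance index \<open>i\<close>, machine \<open>r\<close> and job \<open>j\<close>.\<close>
  let ?C2 = "loop ?C1 (\<lambda>p. njobs (I (fst p)))"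
  note R1 = robust_input_loop[OF R, of "\<lambda>i. nmachs (I i)"]
  note R2 = robust_input_loop[OF R1, of "\<lambda>p. njobs (I (fst p))"]
  have r: "computable ?C2 (\<lambda>q. Atom (snd (fst q)))" "pbounded ?C2 (\<lambda>q. snd (fst q))"
    by (intro computable_loop computable_index pbounded_iter pbounded_index pbounded_nmachs R)+
  have c: "computable ?C2 (\<lambda>q. Atom (snd q))" "pbounded ?C2 snd"
    by (intro computable_index pbounded_index pbounded_njobs R1)+
  note entry = computable_matrix_entry(2)[OF _ r _ c]
  let ?f = "\<lambda>I i j. rden (nominal I i j) * rden (deviation I i j)"
  have s: "small ?C2 (\<lambda>q. rden (nominal (I (fst (fst q))) (snd (fst q)) (snd q)))"
    "small ?C2 (\<lambda>q. rden (deviation (I (fst (fst q))) (snd (fst q)) (snd q)))"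
    by (rule small_matrix_entry(2)[OF pbounded_nominal[OF R2]]
        small_matrix_entry(2)[OF pbounded_deviation[OF R2]]; force)+
  have "computable ?C2 (\<lambda>q. Atom (?f (I (fst (fst q))) (snd (fst q)) (snd q)))"
    by (intro computable_mul entry[OF computable_nominal[OF R2]] entry[OF computable_deviation[OF R2]] s) auto
  note f = computable_prod[OF computable_njobs[OF R1] pbounded_njobs[OF R1] this]
  have s: "small ?C2 (\<lambda>q. ?f (I (fst (fst q))) (snd (fst q)) (snd q))"
    by (intro small_mult s)
  have "computable ?C1 (\<lambda>p. Atom (\<Prod>j<njobs (I (fst p)). ?f (I (fst p)) (snd p) j))"
    by (rule f[OF s]) (simp add: rden_pos)
  note g = computable_prod[OF computable_nmachs[OF R] pbounded_nmachs[OF R] this]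
  have s': "small ?C1 (\<lambda>p. \<Prod>j<njobs (I (fst p)). ?f (I (fst p)) (snd p) j)"
    by (rule small_prod[OF pbounded_njobs[OF R1] s])
  show "computable C (\<lambda>i. Atom (common_den (I i)))"
    unfolding common_den_def by (rule g[OF s']) (simp add: rden_pos prod_pos)
  show "small C (\<lambda>i. common_den (I i))"
    unfolding common_den_def by (rule small_prod[OF pbounded_nmachs[OF R] s'])
qed

lemma
  assumes R: "robust_input C I"
    and r: "computable C (\<lambda>i. Atom (r i))" "\<And>i. i \<in> indices C \<Longrightarrow> r i < nmachs (I i)"
    and c: "computable C (\<lambda>i. Atom (c i))" "\<And>i. i \<in> indices C \<Longrightarrow> c i < njobs (I i)"
  shows computable_nom: "computable C (\<lambda>i. Atom (nom (I i) (r i) (c i)))"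
    and computable_dev: "computable C (\<lambda>i. Atom (dev (I i) (r i) (c i)))"
    and small_nom: "small C (\<lambda>i. nom (I i) (r i) (c i))"
    and small_dev: "small C (\<lambda>i. dev (I i) (r i) (c i))"
proof -
  have r': "pbounded C r"
    by (rule pbounded_le[OF pbounded_nmachs[OF R]]) (use r(2) in \<open>simp add: less_imp_le\<close>)
  have c': "pbounded C c"
    by (rule pbounded_le[OF pbounded_njobs[OF R]]) (use c(2) in \<open>simp add: less_imp_le\<close>)
  note entry = computable_matrix_entry[OF _ r(1) r' r(2) c(1) c' c(2)]
  note nominal = entry[OF computable_nominal[OF R]] small_matrix_entry[OF pbounded_nominal[OF R] r(2) c(2)]
  note deviation = entry[OF computable_deviation[OF R]] small_matrix_entry[OF pbounded_deviation[OF R] r(2) c(2)]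
  note K = computable_common_den[OF R] small_common_den[OF R]
  show "computable C (\<lambda>i. Atom (nom (I i) (r i) (c i)))"
    unfolding nom_def scale_def by (intro computable_div computable_mul small_mult nominal K)
  show "computable C (\<lambda>i. Atom (dev (I i) (r i) (c i)))"
    unfolding dev_def scale_def by (intro computable_div computable_mul small_mult deviation K)
  show "small C (\<lambda>i. nom (I i) (r i) (c i))"
    unfolding nom_def scale_def by (intro small_div small_mult nominal K)
  show "small C (\<lambda>i. dev (I i) (r i) (c i))"
    unfolding dev_def scale_def by (intro small_div small_mult deviation K)
qed

lemma
  assumes R: "robust_input C I"
    and r: "computable C (\<lambda>i. Atom (r i))" "\<And>i. i \<in> indices C \<Longrightarrow> r i < nmachs (I i)"
    and c: "computable C (\<lambda>i. Atom (c i))" "\<And>i. i \<in> indices C \<Longrightarrow> c i < njobs (I i)"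
    and \<theta>: "computable C (\<lambda>i. Atom (\<theta> i))" "small C \<theta>"
  shows computable_trunc_time: "computable C (\<lambda>i. Atom (trunc_time (I i) (\<theta> i) (r i) (c i)))"
    and small_trunc_time: "small C (\<lambda>i. trunc_time (I i) (\<theta> i) (r i) (c i))"
proof -
  note nom = computable_nom[OF R r c] small_nom[OF R r c]
  note dev = computable_dev[OF R r c] small_dev[OF R r c]
  let ?d = "\<lambda>i. if \<theta> i < dev (I i) (r i) (c i) then dev (I i) (r i) (c i) else 0"
  have d: "computable C (\<lambda>i. Atom (?d i))"
    by (rule computable_cong[OF computable_if_less[OF \<theta>(1) dev(1) \<theta>(2) dev(2) dev(1) computable_lit[of _ 0]]])
      auto
  have d': "small C ?d"
    by (intro small_if dev small_const)
  show "computable C (\<lambda>i. Atom (trunc_time (I i) (\<theta> i) (r i) (c i)))"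
    unfolding trunc_time_def by (rule computable_add[OF nom(1) d nom(2) d'])
  show "small C (\<lambda>i. trunc_time (I i) (\<theta> i) (r i) (c i))"
    unfolding trunc_time_def by (rule small_add[OF nom(2) d'])
qed

lemma enc_rat_of_nat: "enc_rat (of_nat a) = Node (Atom a) (Atom 1)"
  by (simp add: enc_rat_def)

text \<open>The size bound is as important as the construction: the given algorithm is polynomial in
  the size of this instance, not of the original one.\<close>

lemma
  assumes R: "robust_input C I"
    and \<theta>: "computable C (\<lambda>i. Atom (\<theta> i))" "small C \<theta>"
  shows computable_reduced: "computable C (\<lambda>i. enc_rcmax (reduced (I i) (\<theta> i)))"
    and pbounded_reduced: "pbounded C (\<lambda>i. data_size (enc_rcmax (reduced (I i) (\<theta> i))))"
proof -
  let ?C1 = "loop C (\<lambda>i. nmachs (I i))"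
  let ?C2 = "loop ?C1 (\<lambda>p. njobs (I (fst p)))"
  note R1 = robust_input_loop[OF R, of "\<lambda>i. nmachs (I i)"]
  note R2 = robust_input_loop[OF R1, of "\<lambda>p. njobs (I (fst p))"]
  have r: "computable ?C2 (\<lambda>q. Atom (snd (fst q)))"
    by (intro computable_loop computable_index)
  have c: "computable ?C2 (\<lambda>q. Atom (snd q))"
    by (intro computable_index)
  have \<theta>2: "computable ?C2 (\<lambda>q. Atom (\<theta> (fst (fst q))))" "small ?C2 (\<lambda>q. \<theta> (fst (fst q)))"
    by (intro computable_loop small_iter \<theta>)+
  let ?t = "\<lambda>i r c. trunc_time (I i) (\<theta> i) r c"
  have t: "computable ?C2 (\<lambda>q. Atom (?t (fst (fst q)) (snd (fst q)) (snd q)))"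
    "small ?C2 (\<lambda>q. ?t (fst (fst q)) (snd (fst q)) (snd q))"
    by (rule computable_trunc_time[OF R2 r _ c _ \<theta>2] small_trunc_time[OF R2 r _ c _ \<theta>2]; force)+
  let ?e = "\<lambda>i r c. enc_rat (of_nat (?t i r c))"
  have "computable ?C2 (\<lambda>q. ?e (fst (fst q)) (snd (fst q)) (snd q))"
    unfolding enc_rat_of_nat by (intro computable_Node computable_lit t)
  then have "computable ?C1 (\<lambda>p. enc_list (?e (fst p) (snd p)) [0..<njobs (I (fst p))])"
    by (rule computable_list[OF computable_njobs[OF R1] pbounded_njobs[OF R1]])
  then have "computable C (\<lambda>i. enc_matrix (nmachs (I i)) (njobs (I i)) (\<lambda>r c. of_nat (?t i r c)))"
    unfolding enc_matrix_def by (rule computable_list[OF computable_nmachs[OF R] pbounded_nmachs[OF R]])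
  then show "computable C (\<lambda>i. enc_rcmax (reduced (I i) (\<theta> i)))"
    unfolding enc_rcmax_def using R
    by (simp add: reduced_def) (intro computable_Node computable_njobs computable_nmachs)
  have "pbounded ?C2 (\<lambda>q. data_size (?e (fst (fst q)) (snd (fst q)) (snd q)))"
    unfolding enc_rat_of_nat data_size.simps
    by (intro pbounded_add pbounded_const t(2)[unfolded small_def])
  then have "pbounded ?C1 (\<lambda>p. data_size (enc_list (?e (fst p) (snd p)) [0..<njobs (I (fst p))]))"
    by (rule pbounded_enc_list[OF pbounded_njobs[OF R1]])
  then have "pbounded C (\<lambda>i. data_size (enc_matrix (nmachs (I i)) (njobs (I i)) (\<lambda>r c. of_nat (?t i r c))))"
    unfolding enc_matrix_def by (rule pbounded_enc_list[OF pbounded_nmachs[OF R]])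
  moreover have "pbounded C (\<lambda>i. floorlog 2 (njobs (I i)))" "pbounded C (\<lambda>i. floorlog 2 (nmachs (I i)))"
    using small_pbounded[OF pbounded_njobs[OF R]] small_pbounded[OF pbounded_nmachs[OF R]]
    by (simp_all add: small_def)
  ultimately have "pbounded C (\<lambda>i. 1 + (1 + floorlog 2 (njobs (I i))) + (1 + (1 + floorlog 2 (nmachs (I i)))
      + data_size (enc_matrix (nmachs (I i)) (njobs (I i)) (\<lambda>r c. of_nat (?t i r c)))))"
    by (intro pbounded_add pbounded_const)
  then show "pbounded C (\<lambda>i. data_size (enc_rcmax (reduced (I i) (\<theta> i))))"
    by (rule pbounded_le) (simp add: enc_rcmax_def reduced_def)
qed

lemma
  assumes R: "robust_input C I"
    and \<theta>: "computable C (\<lambda>i. Atom (\<theta> i))" "small C \<theta>"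
    and \<sigma>: "computable C (\<lambda>i. enc_schedule (I i) (\<sigma> i))" "\<And>i. i \<in> indices C \<Longrightarrow> \<sigma> i \<in> schedules (I i)"
  shows computable_ubound: "computable C (\<lambda>i. Atom (ubound (I i) (\<theta> i) (\<sigma> i)))"
    and small_ubound: "small C (\<lambda>i. ubound (I i) (\<theta> i) (\<sigma> i))"
proof -
  let ?C1 = "loop C (\<lambda>i. nmachs (I i))"
  let ?C2 = "loop ?C1 (\<lambda>p. njobs (I (fst p)))"
  note R1 = robust_input_loop[OF R, of "\<lambda>i. nmachs (I i)"]
  note R2 = robust_input_loop[OF R1, of "\<lambda>p. njobs (I (fst p))"]
  have r: "computable ?C2 (\<lambda>q. Atom (snd (fst q)))" "small ?C2 (\<lambda>q. snd (fst q))"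
    by (intro computable_loop computable_index small_iter small_pbounded[OF pbounded_index] pbounded_nmachs R)+
  have c: "computable ?C2 (\<lambda>q. Atom (snd q))" "pbounded ?C2 snd"
    by (intro computable_index pbounded_index pbounded_njobs R1)+
  have \<theta>2: "computable ?C2 (\<lambda>q. Atom (\<theta> (fst (fst q))))" "small ?C2 (\<lambda>q. \<theta> (fst (fst q)))"
    by (intro computable_loop small_iter \<theta>)+
  let ?t = "\<lambda>i r c. trunc_time (I i) (\<theta> i) r c"
  have t: "computable ?C2 (\<lambda>q. Atom (?t (fst (fst q)) (snd (fst q)) (snd q)))"
    "small ?C2 (\<lambda>q. ?t (fst (fst q)) (snd (fst q)) (snd q))"
    by (rule computable_trunc_time[OF R2 r(1) _ c(1) _ \<theta>2] small_trunc_time[OF R2 r(1) _ c(1) _ \<theta>2]; force)+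
  have "computable ?C2 (\<lambda>q. enc_list (\<lambda>j. Atom (\<sigma> (fst (fst q)) j)) [0..<njobs (I (fst (fst q)))])"
    using computable_loop[OF computable_loop[OF \<sigma>(1)]] unfolding enc_schedule_def .
  then have s: "computable ?C2 (\<lambda>q. Atom (\<sigma> (fst (fst q)) (snd q)))"
    by (rule computable_nth[where f = "\<lambda>q j. Atom (\<sigma> (fst (fst q)) j)", OF _ c]) auto
  \<comment> \<open>Machine numbers in a schedule are below the number of machines; this makes their
    comparison with \<open>r\<close> cheap.\<close>
  have s': "small ?C2 (\<lambda>q. \<sigma> (fst (fst q)) (snd q))"
  proof (rule small_pbounded, rule pbounded_le[OF pbounded_nmachs[OF R2]])
    fix q assume "q \<in> indices ?C2"
    then have "\<sigma> (fst (fst q)) \<in> schedules (I (fst (fst q)))" "snd q < njobs (I (fst (fst q)))"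
      by (auto intro: \<sigma>(2))
    then have "\<sigma> (fst (fst q)) (snd q) \<in> {..<nmachs (I (fst (fst q)))}"
      unfolding schedules_def by (rule PiE_mem[OF _ lessThan_iff[THEN iffD2]])
    then show "\<sigma> (fst (fst q)) (snd q) \<le> nmachs (I (fst (fst q)))"
      by (simp add: less_imp_le)
  qed
  let ?f = "\<lambda>i r c. if \<sigma> i c = r then ?t i r c else 0"
  have f: "computable ?C2 (\<lambda>q. Atom (?f (fst (fst q)) (snd (fst q)) (snd q)))"
    by (rule computable_cong[OF computable_if_eq[OF s r(1) s' r(2) t(1) computable_lit[of _ 0]]])
      auto
  have f': "small ?C2 (\<lambda>q. ?f (fst (fst q)) (snd (fst q)) (snd q))"
    by (intro small_if t small_const)
  let ?g = "\<lambda>i r. \<Sum>j<njobs (I i). ?f i r j"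
  have g: "computable ?C1 (\<lambda>p. Atom (?g (fst p) (snd p)))"
    by (rule computable_sum[OF computable_njobs[OF R1] pbounded_njobs[OF R1] f f'])
  have g': "small ?C1 (\<lambda>p. ?g (fst p) (snd p))"
    by (rule small_sum[OF pbounded_njobs[OF R1] f'])
  have h: "computable C (\<lambda>i. Atom (Max (insert 0 (?g i ` {..<nmachs (I i)}))))"
    by (rule computable_Max[OF computable_nmachs[OF R] pbounded_nmachs[OF R] g g'])
  have h': "small C (\<lambda>i. Max (insert 0 (?g i ` {..<nmachs (I i)})))"
  proof (rule small_le[OF small_sum[OF pbounded_nmachs[OF R] g']])
    fix i
    show "Max (insert 0 (?g i ` {..<nmachs (I i)})) \<le> (\<Sum>r<nmachs (I i). ?g i r)"
      by (intro Max.boundedI) (auto intro!: member_le_sum[where f = "?g i"])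
  qed
  note b = computable_budget[OF R] small_budget[OF R]
  show "computable C (\<lambda>i. Atom (ubound (I i) (\<theta> i) (\<sigma> i)))"
    unfolding ubound_def
    by (rule computable_add[OF h computable_mul[OF b(1) \<theta>(1) b(2) \<theta>(2)] h' small_mult[OF b(2) \<theta>(2)]])
  show "small C (\<lambda>i. ubound (I i) (\<theta> i) (\<sigma> i))"
    unfolding ubound_def by (rule small_add[OF h' small_mult[OF b(2) \<theta>(2)]])
qed

text \<open>The given algorithm \<open>P\<close> is called as a subroutine on the reduced instance;
  \<open>S\<close> and \<open>t\<close> name its output schedule and its cost.\<close>

lemma computable_solution:
  assumes P: "\<And>J. valid_rcmax J \<Longrightarrow> runs P (enc_rcmax J) (enc_schedule J (S J)) (t J)"
      "\<And>J. valid_rcmax J \<Longrightarrow> t J \<le> poly q (data_size (enc_rcmax J))"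
    and R: "robust_input C I"
    and \<theta>: "computable C (\<lambda>i. Atom (\<theta> i))" "small C \<theta>"
  shows "computable C (\<lambda>i. enc_schedule (I i) (S (reduced (I i) (\<theta> i))))"
proof (rule computable_trans[OF computable_reduced[OF R \<theta>]])
  have valid: "valid_rcmax (reduced (I i) (\<theta> i))" if "i \<in> indices C" for i
    using R that by (simp add: robust_input_def valid_reduced)
  \<comment> \<open>A polynomial in the size of the reduced instance, itself polynomially bounded,
    is polynomial in the measure.\<close>
  have "pbounded C (\<lambda>i. t (reduced (I i) (\<theta> i)))"
    by (rule pbounded_le[OF pbounded_poly[OF pbounded_reduced[OF R \<theta>]]]) (rule P(2)[OF valid])
  then show "computable (Ctx (indices C) (msr C) (\<lambda>i. enc_rcmax (reduced (I i) (\<theta> i))))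
      (\<lambda>i. enc_schedule (I i) (S (reduced (I i) (\<theta> i))))"
    using P(1)[OF valid] by (intro computableI[where P = P]) (simp_all add: pbounded_Ctx)
qed

section \<open>The approximation algorithm for the robust problem\<close>

theorem theorem1:
  fixes c :: real
  assumes "\<exists>P. rcmax_approx c P"
  shows "\<exists>Q. robust_approx (c + 1) Q"
proof -
  obtain P where P: "rcmax_approx c P" using assms by blast
  then obtain q :: "nat poly" where approx: "\<forall>J. valid_rcmax J \<longrightarrow> (\<exists>\<sigma> t. \<sigma> \<in> schedules J \<and>
      runs P (enc_rcmax J) (enc_schedule J \<sigma>) t \<and> t \<le> poly q (data_size (enc_rcmax J)) \<and>
      real_of_rat (makespan J \<sigma>) \<le> c * real_of_rat (opt_value makespan J))"
    unfolding rcmax_approx_def poly_time_approx_def by blast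
  \<comment> \<open>Choice turns the schedule and the cost of each run of \<open>P\<close> into
    functions of the instance, as the computability lemmas require.\<close>
  then obtain S t where S: "S J \<in> schedules J" "runs P (enc_rcmax J) (enc_schedule J (S J)) (t J)"
      "t J \<le> poly q (data_size (enc_rcmax J))"
      "real_of_rat (makespan J (S J)) \<le> c * real_of_rat (opt_value makespan J)"
    if "valid_rcmax J" for J
  proof -
    from approx have "\<forall>J. \<exists>\<sigma> t. valid_rcmax J \<longrightarrow> \<sigma> \<in> schedules J \<and>
        runs P (enc_rcmax J) (enc_schedule J \<sigma>) t \<and> t \<le> poly q (data_size (enc_rcmax J)) \<and>
        real_of_rat (makespan J \<sigma>) \<le> c * real_of_rat (opt_value makespan J)" by blast
    then show thesis using that by (simp only: choice_iff) blast
  qed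
  define sol where "sol I \<theta> = S (reduced I \<theta>)" for I \<theta>
  \<comment> \<open>All valid instances at once, given by their encodings and measured by encoding
    size: computability here means a single polynomial-time program.\<close>
  define C where "C = Ctx {I. valid_robust I} (\<lambda>I. data_size (enc_robust I)) enc_robust"
  have sol: "sol I \<theta> \<in> schedules I" if "valid_robust I" for I \<theta>
    using S(1)[OF valid_reduced[OF that]] by (simp add: sol_def)
  let ?n = "\<lambda>I. nmachs I * njobs I"
  define best where "best I = argmin_upto (\<lambda>k. ubound I (threshold I k) (sol I (threshold I k))) (?n I)" for I
  have R: "robust_input C (\<lambda>I. I)"
    unfolding robust_input_def
  proof (intro conjI)
    show "computable C enc_robust"
      using computable_inp[of C] by (simp add: C_def)
    show "pbounded C (\<lambda>I. data_size (enc_robust I))"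
      unfolding pbounded_def by (rule exI[of _ "[:0, 1:]"]) (simp add: C_def)
  qed (simp add: C_def)
  have n: "computable C (\<lambda>I. Atom (?n I))" "pbounded C ?n"
    by (intro computable_mul pbounded_mult computable_nmachs computable_njobs pbounded_nmachs pbounded_njobs
        small_pbounded R)+
  note R1 = robust_input_loop[OF R, of ?n]
  note solution = computable_solution[where P = P and S = S and t = t and q = q, OF S(2,3), folded sol_def]
  have "computable C (\<lambda>I. enc_schedule I (sol I (threshold I (best I))))"
    unfolding best_def
  proof (rule computable_argmin_upto[OF n, where y = "\<lambda>I k. enc_schedule I (sol I (threshold I k))"])
    have 0: "computable C (\<lambda>I. Atom (threshold I 0))" "small C (\<lambda>I. threshold I 0)"
      by (simp_all add: computable_lit small_const)
    show y0: "computable C (\<lambda>I. enc_schedule I (sol I (threshold I 0)))"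
      by (rule solution[OF _ _ R 0])
    show "computable C (\<lambda>I. Atom (ubound I (threshold I 0) (sol I (threshold I 0))))"
      "small C (\<lambda>I. ubound I (threshold I 0) (sol I (threshold I 0)))"
      by (rule computable_ubound[OF R 0 y0] small_ubound[OF R 0 y0], rule sol, simp add: C_def)+
    have nj: "computable (loop C ?n) (\<lambda>p. Atom (njobs (fst p)))" "small (loop C ?n) (\<lambda>p. njobs (fst p))"
      by (intro computable_njobs small_pbounded pbounded_njobs R1)+
    have k: "computable (loop C ?n) (\<lambda>p. Atom (snd p))" "small (loop C ?n) snd"
      by (intro computable_index small_pbounded pbounded_index n)+
    have row: "computable (loop C ?n) (\<lambda>p. Atom (snd p div njobs (fst p)))"
      by (intro computable_div nj k)
    \<comment> \<open>There is no remainder operation, so \<open>mod\<close> is computed by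
      division, multiplication and subtraction.\<close>
    have col: "computable (loop C ?n) (\<lambda>p. Atom (snd p mod njobs (fst p)))"
      unfolding minus_div_mult_eq_mod[symmetric]
      by (intro computable_div computable_mul computable_sub small_mult small_div nj k)
    \<comment> \<open>With no jobs the index range is empty, so the divisor is positive.\<close>
    have less: "snd p div njobs (fst p) < nmachs (fst p)" "snd p mod njobs (fst p) < njobs (fst p)"
      if "p \<in> indices (loop C ?n)" for p
      using that by (auto simp: less_mult_imp_div_less intro!: mod_less_divisor gr0I)
    have \<theta>: "computable (loop C ?n) (\<lambda>p. Atom (threshold (fst p) (Suc (snd p))))"
      "small (loop C ?n) (\<lambda>p. threshold (fst p) (Suc (snd p)))"
      unfolding threshold.simps by (rule computable_dev[OF R1 row less(1) col less(2)]
        small_dev[OF R1 row less(1) col less(2)]; assumption)+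
    show y: "computable (loop C ?n) (\<lambda>p. enc_schedule (fst p) (sol (fst p) (threshold (fst p) (Suc (snd p)))))"
      by (rule solution[OF _ _ R1 \<theta>])
    show "computable (loop C ?n) (\<lambda>p. Atom (ubound (fst p) (threshold (fst p) (Suc (snd p)))
          (sol (fst p) (threshold (fst p) (Suc (snd p))))))"
      "small (loop C ?n) (\<lambda>p. ubound (fst p) (threshold (fst p) (Suc (snd p)))
          (sol (fst p) (threshold (fst p) (Suc (snd p)))))"
      by (rule computable_ubound[OF R1 \<theta> y] small_ubound[OF R1 \<theta> y], rule sol, force simp: C_def)+
  qed
  then obtain Q u where Q: "pbounded C u"
      "\<And>I. valid_robust I \<Longrightarrow> runs Q (enc_robust I) (enc_schedule I (sol I (threshold I (best I)))) (u I)"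
    unfolding computable_def by (auto simp: C_def)
  then obtain q' :: "nat poly" where q': "\<And>I. valid_robust I \<Longrightarrow> u I \<le> poly q' (data_size (enc_robust I))"
    unfolding pbounded_def by (auto simp: C_def)
  have "real_of_rat (robust_makespan I (sol I (threshold I (best I))))
      \<le> (c + 1) * real_of_rat (opt_value robust_makespan I)" if I: "valid_robust I" for I
  proof (rule best_threshold_approx[OF I approx_ratio_nonneg[OF P] sol[OF I]])
    show "real_of_rat (makespan (reduced I \<theta>) (sol I \<theta>)) \<le> c * real_of_rat (opt_value makespan (reduced I \<theta>))" for \<theta>
      using S(4)[OF valid_reduced[OF I]] by (simp add: sol_def)
    show "ubound I (threshold I (best I)) (sol I (threshold I (best I)))
        \<le> ubound I (threshold I k) (sol I (threshold I k))" if "k \<le> ?n I" for k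
      unfolding best_def using that
      by (rule argmin_upto_least[where f = "\<lambda>k. ubound I (threshold I k) (sol I (threshold I k))"])
  qed
  with Q(2) q' sol have "poly_time_approx valid_robust enc_robust robust_makespan (c + 1) Q"
    unfolding poly_time_approx_def by (intro exI[of _ q'] allI impI exI conjI) auto
  then show ?thesis unfolding robust_approx_def by blast
qed

end
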